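(* Let $\alpha>0$ be real, $\Lambda=\mathbb{Z}\alpha+\mathbb{Z}\alpha i$, $\wp(z)=\wp(z;\Lambda)$, and set $e_1=\wp(\alpha/2)$, $e_2=\wp(\alpha i/2)$, $e_3=\wp(\alpha(1+i)/2)$, $a=e_3$ and $c=\sqrt{(e_1-e_3)(e_3-e_2)}$. Let $G$ be the wallpaper group p4mg realised as the group generated by the translations by elements of $\Lambda$, the rotation $z\mapsto iz$, and the glide reflexion $L.z=\overline{z+\tfrac12\alpha(1+i)}$. Then the meromorphic functions $f:\mathbb{C}\to\mathbb{CP}^1$ invariant under the modified action of $G$ are exactly the functions $f(z)=Q\left((\wp(z)-a)/c\right)$, where $Q$ is a rational function of the form $$Q(w)=C\,w^p\,\frac{\prod_k\left((w-a_k)(\bar a_k w+1)\right)^{\lambda_k}}{\prod_l\left((w-b_l)(\bar b_l w+1)\right)^{\mu_l}}$$ with finite products, $a_k,b_l\in\mathbb{C}\setminus\{0\}$, $C\in\mathbb{R}$, $p\in\mathbb{Z}$, positive integers $\lambda_k,\mu_l$, and $\sum_l\mu_l=p+\sum_k\lambda_k$, such that in addition $Q((w-a)/c)=P(w^2)$ for some rational function $P$.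
   Context: Modified action: a sense-preserving $g\in G$, $g.z=az+b$, sends $f$ to $z\mapsto f(g.z)$; a sense-reversing $m\in G$, $m.z=a\bar z+b$, sends $f$ to $z\mapsto\overline{f(m.z)}$ (with $\overline{\infty}=\infty$). $f$ is invariant if it is unchanged by the modified action of every element of $G$. The Weierstrass function of a lattice $\Lambda$ is $\wp(z;\Lambda)=\frac1{z^2}+\sum_{\lambda\in\Lambda\setminus\{0\}}\left(\frac1{(z-\lambda)^2}-\frac1{\lambda^2}\right)$. Empty products are $1$ and empty sums are $0$. *)

theory Defs
  imports
    "HOL-Complex_Analysis.Complex_Analysis"
    "HOL-Computational_Algebra.Polynomial_Factorial"
    "HOL-Computational_Algebra.Field_as_Ring"
    "HOL-Algebra.Bij"
    "HOL-Algebra.Generated_Groups"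
begin

text \<open>The Riemann sphere (complex projective line) is represented by \<^typ>\<open>complex option\<close>, with
  \<^term>\<open>None\<close> as the point at infinity, as in the library's Alexandroff compactification.
  Maps of the plane that fix infinity (affine maps, powers, conjugation) are extended to the
  sphere by \<^const>\<open>map_option\<close>.\<close>

type_synonym sphere = "complex option"

abbreviation infty :: sphere where "infty \<equiv> None"

text \<open>\<open>nicely_meromorphic_on\<close> forces removable singularities to be filled in correctly and uses
  the dummy value 0 at poles, hence the \<open>case\<close>. The constant map to infinity is not meromorphic.\<close>

definition sphere_meromorphic :: "(complex \<Rightarrow> sphere) \<Rightarrow> bool" where
  "sphere_meromorphic f \<longleftrightarrow>
     (let g = (\<lambda>z. case f z of None \<Rightarrow> 0 | Some w \<Rightarrow> w)
      in g nicely_meromorphic_on UNIV \<and> (\<forall>z. f z = infty \<longleftrightarrow> is_pole g z))"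

definition sense_preserving :: "(complex \<Rightarrow> complex) \<Rightarrow> bool" where
  "sense_preserving g \<longleftrightarrow> (\<exists>a b. norm a = 1 \<and> g = (\<lambda>z. a * z + b))"

definition sense_reversing :: "(complex \<Rightarrow> complex) \<Rightarrow> bool" where
  "sense_reversing m \<longleftrightarrow> (\<exists>a b. norm a = 1 \<and> m = (\<lambda>z. a * cnj z + b))"

definition modified_action ::
    "(complex \<Rightarrow> complex) \<Rightarrow> (complex \<Rightarrow> sphere) \<Rightarrow> complex \<Rightarrow> sphere" where
  "modified_action g f =
     (if sense_preserving g then (\<lambda>z. f (g z))
      else if sense_reversing g then (\<lambda>z. map_option cnj (f (g z)))
      else undefined)"

definition modified_invariant ::
    "(complex \<Rightarrow> complex) set \<Rightarrow> (complex \<Rightarrow> sphere) \<Rightarrow> bool" where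
  "modified_invariant G f \<longleftrightarrow> (\<forall>g\<in>G. modified_action g f = f)"

definition square_lattice :: "real \<Rightarrow> complex set" where
  "square_lattice \<alpha> =
     {of_int m * of_real \<alpha> + of_int n * of_real \<alpha> * \<i> | m n :: int. True}"

definition glide_L :: "real \<Rightarrow> complex \<Rightarrow> complex" where
  "glide_L \<alpha> z = cnj (z + of_real \<alpha> * (1 + \<i>) / 2)"

definition p4mg :: "real \<Rightarrow> (complex \<Rightarrow> complex) set" where
  "p4mg \<alpha> = generate (BijGroup UNIV)
     ({(\<lambda>z. z + \<omega>) | \<omega>. \<omega> \<in> square_lattice \<alpha>} \<union> {(\<lambda>z. \<i> * z), glide_L \<alpha>})"

text \<open>The finite values of the Weierstrass function (meaningful off the lattice only), and the
  Weierstrass function as a map to the sphere.\<close>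

definition weierstrass_val :: "complex set \<Rightarrow> complex \<Rightarrow> complex" where
  "weierstrass_val \<Lambda> z =
     1 / z ^ 2 + (\<Sum>\<^sub>\<infinity>\<omega>\<in>\<Lambda> - {0}. 1 / (z - \<omega>) ^ 2 - 1 / \<omega> ^ 2)"

definition weierstrass_p :: "complex set \<Rightarrow> complex \<Rightarrow> sphere" where
  "weierstrass_p \<Lambda> z = (if z \<in> \<Lambda> then infty else Some (weierstrass_val \<Lambda> z))"

text \<open>Rational functions are elements of the field \<^typ>\<open>complex poly fract\<close>;
  \<^term>\<open>quot_of_fract R\<close> is a coprime pair of numerator and denominator, so the following is the
  self-map of the sphere given by \<open>R\<close>.\<close>

definition ratfun_eval :: "complex poly fract \<Rightarrow> sphere \<Rightarrow> sphere" where
  "ratfun_eval R x =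
     (let (p, q) = quot_of_fract R in
      case x of
        Some w \<Rightarrow> if poly q w = 0 then infty else Some (poly p w / poly q w)
      | None \<Rightarrow> if degree p > degree q then infty
                else Some (coeff p (degree q) / lead_coeff q))"

definition antipodal_factor :: "complex \<Rightarrow> complex poly fract" where
  "antipodal_factor a = to_fract ([:-a, 1:] * [:1, cnj a:])"

definition antipodal_form :: "complex poly fract \<Rightarrow> bool" where
  "antipodal_form Q \<longleftrightarrow>
     (\<exists>(C::real) (p::int) (m::nat) (n::nat) (a :: nat \<Rightarrow> complex) (b :: nat \<Rightarrow> complex)
        (lam :: nat \<Rightarrow> nat) (mu :: nat \<Rightarrow> nat).
        (\<forall>k<m. a k \<noteq> 0 \<and> lam k > 0) \<and>
        (\<forall>l<n. b l \<noteq> 0 \<and> mu l > 0) \<and>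
        (\<Sum>l<n. int (mu l)) = p + (\<Sum>k<m. int (lam k)) \<and>
        Q = to_fract [:of_real C:] * to_fract [:0, 1:] powi p *
            ((\<Prod>k<m. antipodal_factor (a k) ^ lam k) /
             (\<Prod>l<n. antipodal_factor (b l) ^ mu l)))"

end

theory Submission
  imports Defs "HOL-Computational_Algebra.Fundamental_Theorem_Algebra"
begin

text \<open>For the square lattice, \<open>\<wp>(iz) = - \<wp>(z)\<close> gives \<open>e3 = 0\<close> and \<open>e2 = - e1\<close>, with \<open>e1\<close> real and nonzero,
  so \<open>c = |e1|\<close>, and Liouville's theorem gives \<open>\<wp>(z) \<wp>(z + w3) = - c\<^sup>2\<close> for the half period
  \<open>w3 = \<alpha>(1 + i)/2\<close>. In the coordinate \<open>w = \<wp>/c\<close> the rotation therefore acts as \<open>w \<mapsto> - w\<close> and the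
  glide reflexion as the antipodal map \<open>w \<mapsto> - 1 / cnj w\<close>. An invariant function is even and elliptic,
  hence \<open>Q(w)\<close> with \<open>Q\<close> rational; invariance under the glide reflexion says that \<open>Q\<close> commutes with the
  antipodal map and conjugation, so that its zeros and poles come in antipodal pairs, and invariance
  under the rotation says that \<open>Q\<close> is even. Identities between rational functions are checked at all
  but finitely many points and carried over to the whole sphere by uniqueness of limits.\<close>

section \<open>Rational functions on the sphere\<close>

text \<open>The obstacle is that a map to the sphere has no arithmetic at its poles, and that
  evaluating a fraction in lowest terms is not compatible with products at the zeros of cancelled
  factors. The arguments therefore run on complex-valued representatives (\<open>ratfun_val\<close>,
  \<open>wp\<close>) whose values at isolated points are irrelevant, and values on the sphere are
  recovered as limits along punctured neighbourhoods. The value \<open>e3\<close> vanishes because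
  the rotation fixes the half period modulo the lattice. Translation by it exchanges the other two
  half periods, and evaluation there identifies the constant in the product formula; neither the
  differential equation of \<open>wp\<close> nor an addition theorem enters. The exponent condition
  in the form of \<open>Q\<close> has a simple origin: \<open>(w - a) * (cnj a * w + 1)\<close> is
  antipodally symmetric only after division by \<open>w\<close>, so each factor carries one power of
  \<open>1 / w\<close>. The antipodal map has no fixed point, so a zero or pole and its antipode are
  two distinct points that can be split off together.\<close>

definition sphere_tendsto :: "('b \<Rightarrow> complex) \<Rightarrow> sphere \<Rightarrow> 'b filter \<Rightarrow> bool" where
  "sphere_tendsto h x F \<longleftrightarrow>
     (case x of None \<Rightarrow> filterlim h at_infinity F | Some w \<Rightarrow> (h \<longlongrightarrow> w) F)"

text \<open>A complex-valued stand-in for the rational map, with the value 0 of a division by zero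
  at the poles. It is meaningful up to finite sets only.\<close>

definition ratfun_val :: "complex poly fract \<Rightarrow> complex \<Rightarrow> complex" where
  "ratfun_val R w = poly (fst (quot_of_fract R)) w / poly (snd (quot_of_fract R)) w"

text \<open>The filter lives on the plane even for the point at infinity, so that complex-valued
  functions have limits along it at every point of the sphere.\<close>

definition punctured_nhds :: "sphere \<Rightarrow> complex filter" where
  "punctured_nhds x = (case x of None \<Rightarrow> at_infinity | Some w \<Rightarrow> at w)"

lemma sphere_tendsto_simps [simp]:
  "sphere_tendsto h None F \<longleftrightarrow> filterlim h at_infinity F"
  "sphere_tendsto h (Some w) F \<longleftrightarrow> (h \<longlongrightarrow> w) F"
  by (simp_all add: sphere_tendsto_def)

text \<open>This is the device by which two values on the sphere are proved equal: both are
  exhibited as limits of one complex-valued function.\<close>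

lemma sphere_tendsto_unique:
  assumes "F \<noteq> bot" "sphere_tendsto h x F" "sphere_tendsto h y F"
  shows "x = y"
  using assms not_tendsto_and_filterlim_at_infinity[of F h] tendsto_unique[of F h]
  by (cases x; cases y) auto

lemma sphere_tendsto_cong:
  assumes "eventually (\<lambda>z. h z = k z) F"
  shows "sphere_tendsto h x F \<longleftrightarrow> sphere_tendsto k x F"
  using filterlim_cong[OF refl refl assms] by (cases x) auto

lemma punctured_nhds_neq_bot [simp]: "punctured_nhds x \<noteq> bot"
  by (cases x) (simp_all add: punctured_nhds_def trivial_limit_at_infinity)

text \<open>A finite set is bounded, so it is avoided near infinity, and closed, so it is avoided
  around a point. Statements true off a finite set thus become available for limits at every point
  of the sphere.\<close>

lemma punctured_nhds_le_cofinite: "punctured_nhds x \<le> cofinite"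
proof (rule filter_leI)
  fix P :: "complex \<Rightarrow> bool" assume "eventually P cofinite"
  hence fin: "finite {w. \<not> P w}" by (simp add: eventually_cofinite)
  show "eventually P (punctured_nhds x)"
  proof (cases x)
    case None
    from fin obtain B where "\<forall>w\<in>{w. \<not> P w}. norm w \<le> B"
      using finite_imp_bounded bounded_iff by blast
    hence "\<forall>w. norm w \<ge> B + 1 \<longrightarrow> P w" by force
    thus ?thesis using None by (auto simp: punctured_nhds_def eventually_at_infinity)
  next
    case (Some w)
    have "eventually (\<lambda>z. z \<in> - ({v. \<not> P v} - {w})) (nhds w)"
      using fin by (intro eventually_nhds_in_open open_Compl finite_imp_closed finite_Diff) auto
    thus ?thesis using Some by (auto simp: punctured_nhds_def eventually_at_filter elim: eventually_mono)
  qed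
qed

lemma sphere_tendsto_punctured_nhds: "sphere_tendsto (\<lambda>w. w) x (punctured_nhds x)"
  by (cases x) (simp_all add: punctured_nhds_def filterlim_ident)

lemma eventually_cofinite_poly_neq_0:
  fixes p :: "complex poly"
  shows "p \<noteq> 0 \<Longrightarrow> eventually (\<lambda>w. poly p w \<noteq> 0) cofinite"
  by (simp add: eventually_cofinite poly_roots_finite)

text \<open>Only the term of exponent \<open>n\<close> survives division by \<open>w ^ n\<close>.
  Allowing \<open>n\<close> above the degree lets numerator and denominator be divided by the same
  power.\<close>

lemma poly_over_power_at_infinity:
  fixes p :: "complex poly"
  assumes "degree p \<le> n"
  shows "((\<lambda>w. poly p w / w ^ n) \<longlongrightarrow> coeff p n) at_infinity"
proof -
  have lim: "((\<lambda>w. coeff p i * w ^ i / w ^ n) \<longlongrightarrow> (if i = n then coeff p n else 0)) at_infinity"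
    if "i \<le> n" for i
  proof (cases "i = n")
    case True
    have "eventually (\<lambda>w::complex. w \<noteq> 0) at_infinity"
      by (rule eventually_not_equal_at_infinity)
    hence "eventually (\<lambda>w. coeff p i * w ^ i / w ^ n = coeff p n) at_infinity"
      by eventually_elim (simp add: True)
    thus ?thesis using True by (simp add: tendsto_eventually)
  next
    case False
    with that have lt: "n - i > 0" by simp
    have "((\<lambda>w::complex. inverse (w ^ (n - i))) \<longlongrightarrow> 0) at_infinity"
      using lt by (intro filterlim_compose[OF tendsto_inverse_0] filterlim_power_at_infinity filterlim_ident) auto
    hence "((\<lambda>w. coeff p i * inverse (w ^ (n - i))) \<longlongrightarrow> coeff p i * 0) at_infinity"
      by (intro tendsto_intros)
    moreover have "eventually (\<lambda>w. coeff p i * inverse (w ^ (n - i)) = coeff p i * w ^ i / w ^ n) at_infinity"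
      using eventually_not_equal_at_infinity[of 0]
    proof eventually_elim
      case (elim w)
      have "w ^ n = w ^ i * w ^ (n - i)" using that by (simp flip: power_add)
      thus ?case using elim by (simp add: field_simps)
    qed
    ultimately show ?thesis using False by (auto elim: Lim_transform_eventually)
  qed
  have "((\<lambda>w. \<Sum>i\<le>n. coeff p i * w ^ i / w ^ n) \<longlongrightarrow> (\<Sum>i\<le>n. if i = n then coeff p n else 0)) at_infinity"
    by (intro tendsto_sum lim) auto
  also have "(\<Sum>i\<le>n. if i = n then coeff p n else 0) = coeff p n" by simp
  also have "(\<lambda>w. \<Sum>i\<le>n. coeff p i * w ^ i / w ^ n) = (\<lambda>w. poly p w / w ^ n)"
  proof
    fix w
    have "(\<Sum>i\<le>degree p. coeff p i * w ^ i) = (\<Sum>i\<le>n. coeff p i * w ^ i)"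
      using assms by (intro sum.mono_neutral_left) (auto simp: coeff_eq_0)
    thus "(\<Sum>i\<le>n. coeff p i * w ^ i / w ^ n) = poly p w / w ^ n"
      by (simp add: poly_altdef sum_divide_distrib)
  qed
  finally show ?thesis .
qed

text \<open>This is continuity of a rational map of the sphere. At a pole, coprimality keeps the
  numerator away from 0; the condition on the denominator excludes points where division by zero
  would produce a spurious 0 close to the pole.\<close>

lemma sphere_tendsto_ratfun:
  assumes h: "sphere_tendsto h x F"
    and nz: "eventually (\<lambda>z. poly (snd (quot_of_fract R)) (h z) \<noteq> 0) F"
  shows "sphere_tendsto (\<lambda>z. ratfun_val R (h z)) (ratfun_eval R x) F"
proof -
  obtain p q where pq: "quot_of_fract R = (p, q)" by (cases "quot_of_fract R")
  have q0: "q \<noteq> 0" using snd_quot_of_fract_nonzero[of R] pq by simp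
  have cop: "coprime p q" using coprime_quot_of_fract[of R] pq by simp
  have val: "ratfun_val R = (\<lambda>w. poly p w / poly q w)"
    by (auto simp: ratfun_val_def pq)
  have nz: "eventually (\<lambda>z. poly q (h z) \<noteq> 0) F" using nz pq by simp
  show ?thesis
  proof (cases x)
    case (Some w)
    have hw: "(h \<longlongrightarrow> w) F" using h Some by simp
    have lp: "((\<lambda>z. poly p (h z)) \<longlongrightarrow> poly p w) F"
     and lq: "((\<lambda>z. poly q (h z)) \<longlongrightarrow> poly q w) F"
      using hw by (auto intro!: tendsto_intros)
    show ?thesis
    proof (cases "poly q w = 0")
      case True
      have "poly p w \<noteq> 0"
        using cop True by (metis coprime_poly_0)
      moreover have "filterlim (\<lambda>z. poly q (h z)) (at 0) F"
        using lq nz True by (simp add: filterlim_at)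
      ultimately have "filterlim (\<lambda>z. poly p (h z) / poly q (h z)) at_infinity F"
        unfolding divide_inverse using lp
        by (intro tendsto_mult_filterlim_at_infinity filterlim_compose[OF filterlim_inverse_at_infinity])
      thus ?thesis using Some True by (simp add: val ratfun_eval_def pq)
    next
      case False
      thus ?thesis using lp lq Some by (auto simp: val ratfun_eval_def pq intro!: tendsto_intros)
    qed
  next
    case None
    have hw: "filterlim h at_infinity F" using h None by simp
    show ?thesis
    proof (cases "degree p > degree q")
      case False
      have "((\<lambda>w. (poly p w / w ^ degree q) / (poly q w / w ^ degree q)) \<longlongrightarrow> coeff p (degree q) / lead_coeff q) at_infinity"
        using False q0 by (intro tendsto_divide poly_over_power_at_infinity) auto
      moreover have "eventually (\<lambda>w. (poly p w / w ^ degree q) / (poly q w / w ^ degree q) = poly p w / poly q w) at_infinity"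
        using eventually_not_equal_at_infinity[of 0] by eventually_elim simp
      ultimately have "((\<lambda>w. poly p w / poly q w) \<longlongrightarrow> coeff p (degree q) / lead_coeff q) at_infinity"
        by (rule Lim_transform_eventually)
      from filterlim_compose[OF this hw] show ?thesis
        using None False by (simp add: val ratfun_eval_def pq)
    next
      case True
      hence p0: "p \<noteq> 0" by auto
      \<comment> \<open>Growth at infinity is obtained from the reciprocal, which tends to 0 without
        vanishing.\<close>
      have "((\<lambda>w. (poly q w / w ^ degree p) / (poly p w / w ^ degree p)) \<longlongrightarrow> coeff q (degree p) / lead_coeff p) at_infinity"
        using True p0 by (intro tendsto_divide poly_over_power_at_infinity) auto
      moreover have "eventually (\<lambda>w. (poly q w / w ^ degree p) / (poly p w / w ^ degree p) = poly q w / poly p w) at_infinity"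
        using eventually_not_equal_at_infinity[of 0] by eventually_elim simp
      ultimately have l: "((\<lambda>w. poly q w / poly p w) \<longlongrightarrow> 0) at_infinity"
        using True by (simp add: Lim_transform_eventually coeff_eq_0)
      have pn: "eventually (\<lambda>w. poly p w \<noteq> 0) at_infinity"
        using filter_leD[OF punctured_nhds_le_cofinite[of None] eventually_cofinite_poly_neq_0[OF p0]]
        by (simp add: punctured_nhds_def)
      have qn: "eventually (\<lambda>w. poly q w \<noteq> 0) at_infinity"
        using filter_leD[OF punctured_nhds_le_cofinite[of None] eventually_cofinite_poly_neq_0[OF q0]]
        by (simp add: punctured_nhds_def)
      have "eventually (\<lambda>w. poly q w / poly p w \<noteq> 0) at_infinity"
        using pn qn by eventually_elim simp
      with l have "filterlim (\<lambda>w. poly q w / poly p w) (at 0) at_infinity"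
        by (simp add: filterlim_at)
      hence "filterlim (\<lambda>w. inverse (poly q w / poly p w)) at_infinity at_infinity"
        by (rule filterlim_compose[OF filterlim_inverse_at_infinity])
      hence "filterlim (\<lambda>w. poly p w / poly q w) at_infinity at_infinity" by simp
      from filterlim_compose[OF this hw] show ?thesis
        using None True by (simp add: val ratfun_eval_def pq)
    qed
  qed
qed

lemma eventually_cofinite_ratfun_den:
  fixes R :: "complex poly fract"
  shows "eventually (\<lambda>w. poly (snd (quot_of_fract R)) w \<noteq> 0) cofinite"
  by (rule eventually_cofinite_poly_neq_0) simp

lemma ratfun_eval_tendsto: 
  "sphere_tendsto (ratfun_val R) (ratfun_eval R x) (punctured_nhds x)"
  using sphere_tendsto_ratfun[OF sphere_tendsto_punctured_nhds, of R x]
    filter_leD[OF punctured_nhds_le_cofinite eventually_cofinite_ratfun_den] by blast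

lemma ratfun_eq_quot:
  fixes R :: "complex poly fract"
  shows "R = to_fract (fst (quot_of_fract R)) / to_fract (snd (quot_of_fract R))"
  by (simp flip: Fract_conv_to_fract)

lemma ratfun_cases:
  fixes R :: "complex poly fract"
  obtains p q where "R = to_fract p / to_fract q" "q \<noteq> 0"
  using ratfun_eq_quot[of R] snd_quot_of_fract_nonzero[of R] by metis

text \<open>Reduction to lowest terms changes the pointwise quotient at most at zeros of the two
  denominators. Any convenient fraction can therefore replace the coprime pair behind
  \<open>ratfun_val\<close>.\<close>

lemma ratfun_val_Fract:
  assumes "q \<noteq> 0"
  shows "eventually (\<lambda>w. ratfun_val (to_fract p / to_fract q) w = poly p w / poly q w) cofinite"
proof -
  define R where "R = to_fract p / to_fract q"
  define p' q' where "p' = fst (quot_of_fract R)" and "q' = snd (quot_of_fract R)"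
  have q': "q' \<noteq> 0" by (simp add: q'_def)
  have "to_fract p' / to_fract q' = to_fract p / to_fract q"
    unfolding p'_def q'_def R_def[symmetric] by (rule ratfun_eq_quot[symmetric])
  hence "to_fract (p' * q) = to_fract (p * q')"
    using assms q' by (simp add: field_simps)
  hence "p' * q = p * q'" by (simp only: to_fract_eq_iff)
  hence eq: "poly p' w * poly q w = poly p w * poly q' w" for w
    by (metis poly_mult)
  show ?thesis
    using eventually_cofinite_poly_neq_0[OF assms] eventually_cofinite_poly_neq_0[OF q']
    by eventually_elim (use eq in \<open>simp add: ratfun_val_def field_simps p'_def q'_def R_def\<close>)
qed


lemma ratfun_val_to_fract [simp]: "ratfun_val (to_fract p) w = poly p w"
  by (simp add: ratfun_val_def)

lemma ratfun_val_mult: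
  "eventually (\<lambda>w. ratfun_val (R * S) w = ratfun_val R w * ratfun_val S w) cofinite"
proof -
  obtain p q where R: "R = to_fract p / to_fract q" "q \<noteq> 0" by (rule ratfun_cases)
  obtain p' q' where S: "S = to_fract p' / to_fract q'" "q' \<noteq> 0" by (rule ratfun_cases)
  have RS: "R * S = to_fract (p * p') / to_fract (q * q')" using R S by simp
  have qq: "q * q' \<noteq> 0" using R S by simp
  show ?thesis
    using ratfun_val_Fract[OF qq, of "p * p'"] ratfun_val_Fract[OF R(2), of p] ratfun_val_Fract[OF S(2), of p']
    unfolding RS[symmetric] R(1)[symmetric] S(1)[symmetric]
    by eventually_elim simp
qed

lemma ratfun_val_inverse:
  "eventually (\<lambda>w. ratfun_val (inverse R) w = inverse (ratfun_val R w)) cofinite"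
proof (cases "R = 0")
  case True
  then show ?thesis by (simp add: ratfun_val_def)
next
  case False
  obtain p q where R: "R = to_fract p / to_fract q" "q \<noteq> 0" by (rule ratfun_cases)
  hence p: "p \<noteq> 0" using False by auto
  have I: "inverse R = to_fract q / to_fract p" using R by simp
  show ?thesis
    using ratfun_val_Fract[OF p, of q] ratfun_val_Fract[OF R(2), of p]
    unfolding I[symmetric] R(1)[symmetric]
    by eventually_elim simp
qed

lemma poly_eq_of_infinite:
  fixes p q :: "complex poly"
  assumes "infinite S" "\<And>w. w \<in> S \<Longrightarrow> poly p w = poly q w"
  shows "p = q"
proof (rule ccontr)
  assume "p \<noteq> q"
  hence "finite {w. poly (p - q) w = 0}" by (intro poly_roots_finite) auto
  moreover have "S \<subseteq> {w. poly (p - q) w = 0}" using assms by auto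
  ultimately show False using assms(1) finite_subset by blast
qed

section \<open>Antipodally symmetric rational functions\<close>

text \<open>Finitely many exceptions are allowed because \<open>ratfun_val\<close> is multiplicative
  only up to finite sets; closure under products and inverses then follows pointwise.\<close>

definition antipodal_symmetric :: "complex poly fract \<Rightarrow> bool" where
  "antipodal_symmetric R \<longleftrightarrow>
     eventually (\<lambda>w. ratfun_val R w = cnj (ratfun_val R (- 1 / cnj w))) cofinite"

text \<open>In the plane \<open>- 1 / cnj 0\<close> would evaluate to 0, so the exchange of 0 and
  infinity is written out.\<close>

definition sphere_antipode :: "sphere \<Rightarrow> sphere" where
  "sphere_antipode x =
     (case x of None \<Rightarrow> Some 0 | Some w \<Rightarrow> if w = 0 then None else Some (- 1 / cnj w))"

text \<open>With \<open>1 / 0 = 0\<close> the map \<open>w \<mapsto> - 1 / cnj w\<close> fixes 0 and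
  stays injective on the whole plane, so preimages of finite sets are finite.\<close>

lemma eventually_cofinite_antipode:
  assumes "eventually P cofinite"
  shows "eventually (\<lambda>w. P (- 1 / cnj w)) cofinite"
proof -
  have "inj (\<lambda>w. - 1 / cnj w)"
    by (rule injI) (simp add: divide_simps split: if_splits)
  hence "finite ((\<lambda>w. - 1 / cnj w) -` {w. \<not> P w})"
    using assms by (intro finite_vimageI) (auto simp: eventually_cofinite)
  thus ?thesis by (simp add: eventually_cofinite vimage_def)
qed

lemma antipodal_symmetric_mult:
  assumes "antipodal_symmetric R" "antipodal_symmetric S"
  shows "antipodal_symmetric (R * S)"
  unfolding antipodal_symmetric_def
  using assms[unfolded antipodal_symmetric_def] ratfun_val_mult[of R S]
    eventually_cofinite_antipode[OF ratfun_val_mult[of R S]]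
  by eventually_elim simp

lemma antipodal_symmetric_inverse:
  assumes "antipodal_symmetric R"
  shows "antipodal_symmetric (inverse R)"
  unfolding antipodal_symmetric_def
  using assms[unfolded antipodal_symmetric_def] ratfun_val_inverse[of R]
    eventually_cofinite_antipode[OF ratfun_val_inverse[of R]]
  by eventually_elim simp

lemma antipodal_symmetric_divide:
  "antipodal_symmetric R \<Longrightarrow> antipodal_symmetric S \<Longrightarrow> antipodal_symmetric (R / S)"
  by (simp add: divide_inverse antipodal_symmetric_mult antipodal_symmetric_inverse)

lemma antipodal_symmetric_of_real: "antipodal_symmetric (to_fract [:of_real C:])"
  by (simp add: antipodal_symmetric_def)

lemma antipodal_symmetric_power:
  "antipodal_symmetric R \<Longrightarrow> antipodal_symmetric (R ^ n)"
proof (induction n)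
  case 0
  show ?case using antipodal_symmetric_of_real[of 1] by (simp add: pCons_one)
qed (simp add: antipodal_symmetric_mult)

lemma antipodal_symmetric_prod:
  "(\<And>k. k \<in> A \<Longrightarrow> antipodal_symmetric (R k)) \<Longrightarrow> antipodal_symmetric (prod R A)"
proof (induction A rule: infinite_finite_induct)
  case (insert x A)
  thus ?case by (simp add: antipodal_symmetric_mult)
qed (use antipodal_symmetric_of_real[of 1] in \<open>simp_all add: pCons_one\<close>)

text \<open>Passing to the antipode and conjugating multiplies
  \<open>(w - a) * (1 + cnj a * w)\<close> by \<open>- 1 / w ^ 2\<close>, and it does the same to
  \<open>w\<close>. The quotient is therefore unchanged.\<close>

lemma antipodal_symmetric_factor:
  "antipodal_symmetric (antipodal_factor a / to_fract [:0, 1:])"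
proof -
  let ?R = "antipodal_factor a / to_fract [:0, 1:]"
  have ev: "eventually (\<lambda>w. ratfun_val ?R w = (w - a) * (1 + cnj a * w) / w) cofinite"
    using ratfun_val_Fract[of "[:0, 1:]" "[:-a, 1:] * [:1, cnj a:]"]
    by (simp add: antipodal_factor_def algebra_simps)
  have nz: "eventually (\<lambda>w::complex. w \<noteq> 0) cofinite"
    by (simp add: eventually_cofinite)
  show ?thesis unfolding antipodal_symmetric_def
    using ev eventually_cofinite_antipode[OF ev] nz
  proof eventually_elim
    case (elim w)
    have "(w - a) * (1 + cnj a * w) / w = (- 1 / w - cnj a) * (1 + a * (- 1 / w)) / (- 1 / w)"
      using elim(3) by (simp add: field_simps)
    thus ?case unfolding elim(1,2) by simp
  qed
qed

lemma antipodal_formI: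
  fixes C :: real and p :: int and m n :: nat and a b :: "nat \<Rightarrow> complex" and lam mu :: "nat \<Rightarrow> nat"
  assumes "\<And>k. k < m \<Longrightarrow> a k \<noteq> 0 \<and> lam k > 0" "\<And>l. l < n \<Longrightarrow> b l \<noteq> 0 \<and> mu l > 0"
    and "(\<Sum>l<n. int (mu l)) = p + (\<Sum>k<m. int (lam k))"
    and "Q = to_fract [:of_real C:] * to_fract [:0, 1:] powi p *
            ((\<Prod>k<m. antipodal_factor (a k) ^ lam k) /
             (\<Prod>l<n. antipodal_factor (b l) ^ mu l))"
  shows "antipodal_form Q"
  unfolding antipodal_form_def
  by (rule exI[of _ C], rule exI[of _ p], rule exI[of _ m], rule exI[of _ n],
      rule exI[of _ a], rule exI[of _ b], rule exI[of _ lam], rule exI[of _ mu])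
     (use assms in auto)

lemma antipodal_formE:
  assumes "antipodal_form Q"
  obtains C :: real and p :: int and m n :: nat and a b :: "nat \<Rightarrow> complex" and lam mu :: "nat \<Rightarrow> nat"
  where "\<forall>k<m. a k \<noteq> 0 \<and> lam k > 0" "\<forall>l<n. b l \<noteq> 0 \<and> mu l > 0"
    and "(\<Sum>l<n. int (mu l)) = p + (\<Sum>k<m. int (lam k))"
    and "Q = to_fract [:of_real C:] * to_fract [:0, 1:] powi p *
            ((\<Prod>k<m. antipodal_factor (a k) ^ lam k) /
             (\<Prod>l<n. antipodal_factor (b l) ^ mu l))"
  using assms unfolding antipodal_form_def
  by (elim exE conjE) (rule that)

text \<open>The exponent condition says that \<open>p\<close> is the difference of the exponent
  sums, so the power of \<open>w\<close> can be shared out, one \<open>1 / w\<close> to each factor.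
  What results is a real constant times symmetric quotients.\<close>

lemma antipodal_form_imp_symmetric:
  assumes "antipodal_form Q"
  shows "antipodal_symmetric Q"
proof (rule antipodal_formE[OF assms])
  fix C :: real and p :: int and m :: nat and n :: nat and a :: "nat \<Rightarrow> complex" and b :: "nat \<Rightarrow> complex" and lam :: "nat \<Rightarrow> nat" and mu :: "nat \<Rightarrow> nat"
  assume
      "\<forall>k<m. a k \<noteq> 0 \<and> lam k > 0" "\<forall>l<n. b l \<noteq> 0 \<and> mu l > 0"
    and sum: "(\<Sum>l<n. int (mu l)) = p + (\<Sum>k<m. int (lam k))"
    and Q': "Q = to_fract [:of_real C:] * to_fract [:0, 1:] powi p *
            ((\<Prod>k<m. antipodal_factor (a k) ^ lam k) /
             (\<Prod>l<n. antipodal_factor (b l) ^ mu l))"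
  define X :: "complex poly fract" where "X = to_fract [:0, 1:]"
  have X: "X \<noteq> 0" by (simp add: X_def)
  note Q = Q'[folded X_def]
  have pr: "(\<Prod>k<m. (antipodal_factor (a k) / X) ^ lam k) =
      (\<Prod>k<m. antipodal_factor (a k) ^ lam k) / X ^ (\<Sum>k<m. lam k)" for m a and lam :: "nat \<Rightarrow> nat"
    by (simp add: power_divide prod_dividef power_sum)
  have p: "p = int (\<Sum>l<n. mu l) - int (\<Sum>k<m. lam k)" using sum by simp
  have "X powi p = X ^ (\<Sum>l<n. mu l) / X ^ (\<Sum>k<m. lam k)"
    unfolding p by (subst power_int_diff) (use X in \<open>simp_all only: power_int_of_nat simp_thms\<close>)
  hence "Q = to_fract [:of_real C:] * ((\<Prod>k<m. (antipodal_factor (a k) / X) ^ lam k) /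
             (\<Prod>l<n. (antipodal_factor (b l) / X) ^ mu l))"
    unfolding Q pr by simp
  thus ?thesis unfolding X_def
    by (auto intro!: antipodal_symmetric_mult antipodal_symmetric_divide antipodal_symmetric_prod
        antipodal_symmetric_power antipodal_symmetric_factor antipodal_symmetric_of_real)
qed

lemma sphere_tendsto_cnj:
  "sphere_tendsto h x F \<Longrightarrow> sphere_tendsto (\<lambda>z. cnj (h z)) (map_option cnj x) F"
  by (cases x) (auto intro!: tendsto_intros simp: filterlim_at_infinity_conv_norm_at_top)

lemma sphere_antipode_tendsto:
  "sphere_tendsto (\<lambda>w. - 1 / cnj w) (sphere_antipode x) (punctured_nhds x)"
proof (cases x)
  case None
  have "((\<lambda>w::complex. cnj (inverse w)) \<longlongrightarrow> cnj 0) at_infinity"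
    by (intro tendsto_cnj tendsto_inverse_0)
  hence "((\<lambda>w::complex. - cnj (inverse w)) \<longlongrightarrow> - cnj 0) at_infinity"
    by (rule tendsto_minus)
  thus ?thesis using None by (simp add: sphere_antipode_def punctured_nhds_def divide_inverse)
next
  case (Some w)
  show ?thesis
  proof (cases "w = 0")
    case True
    have "filterlim (\<lambda>w::complex. inverse w) at_infinity (at 0)"
      by (rule filterlim_inverse_at_infinity)
    hence "filterlim (\<lambda>w::complex. - cnj (inverse w)) at_infinity (at 0)"
      by (simp add: filterlim_at_infinity_conv_norm_at_top norm_inverse)
    thus ?thesis using Some True by (simp add: sphere_antipode_def punctured_nhds_def divide_inverse)
  next
    case False
    thus ?thesis using Some
      by (auto simp: sphere_antipode_def punctured_nhds_def intro!: tendsto_eq_intros)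
  qed
qed

text \<open>Both sides are limits at \<open>x\<close> of \<open>w \<mapsto> R (- 1 / cnj w)\<close>:
  one by continuity of \<open>R\<close> at the antipode, the other by conjugating the limit of
  \<open>R\<close> at \<open>x\<close>.\<close>

lemma ratfun_eval_antipode:
  assumes "antipodal_symmetric R"
  shows "ratfun_eval R (sphere_antipode x) = map_option cnj (ratfun_eval R x)"
proof (rule sphere_tendsto_unique[OF punctured_nhds_neq_bot[of x]])
  show "sphere_tendsto (\<lambda>w. ratfun_val R (- 1 / cnj w)) (ratfun_eval R (sphere_antipode x)) (punctured_nhds x)"
    by (rule sphere_tendsto_ratfun[OF sphere_antipode_tendsto
          filter_leD[OF punctured_nhds_le_cofinite eventually_cofinite_antipode[OF eventually_cofinite_ratfun_den]]])
  have "eventually (\<lambda>w. ratfun_val R w = cnj (ratfun_val R (- 1 / cnj w))) (punctured_nhds x)"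
    by (rule filter_leD[OF punctured_nhds_le_cofinite assms[unfolded antipodal_symmetric_def]])
  hence "eventually (\<lambda>w. cnj (ratfun_val R w) = ratfun_val R (- 1 / cnj w)) (punctured_nhds x)"
    by eventually_elim simp
  thus "sphere_tendsto (\<lambda>w. ratfun_val R (- 1 / cnj w)) (map_option cnj (ratfun_eval R x)) (punctured_nhds x)"
    using sphere_tendsto_cnj[OF ratfun_eval_tendsto[of R x]] by (simp only: sphere_tendsto_cong)
qed

section \<open>Splitting off antipodal pairs of zeros and poles\<close>

lemma antipodal_form_times_factor:
  assumes "antipodal_form R" "a \<noteq> 0"
  shows "antipodal_form (R * (antipodal_factor a / to_fract [:0, 1:]))"
proof (rule antipodal_formE[OF assms(1)])
  fix C :: real and p :: int and m :: nat and n :: nat and a' :: "nat \<Rightarrow> complex" and b :: "nat \<Rightarrow> complex" and lam :: "nat \<Rightarrow> nat" and mu :: "nat \<Rightarrow> nat"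
  assume
      nz: "\<forall>k<m. a' k \<noteq> 0 \<and> lam k > 0" "\<forall>l<n. b l \<noteq> 0 \<and> mu l > 0"
    and sum: "(\<Sum>l<n. int (mu l)) = p + (\<Sum>k<m. int (lam k))"
    and R': "R = to_fract [:of_real C:] * to_fract [:0, 1:] powi p *
            ((\<Prod>k<m. antipodal_factor (a' k) ^ lam k) /
             (\<Prod>l<n. antipodal_factor (b l) ^ mu l))"
  define X :: "complex poly fract" where "X = to_fract [:0, 1:]"
  have X: "X \<noteq> 0" by (simp add: X_def)
  note R = R'[folded X_def]
  have Xp: "X powi (p - 1) = X powi p / X" by (subst power_int_diff) (use X in auto)
  have "(\<Prod>k<m. antipodal_factor ((a'(m := a)) k) ^ (lam(m := 1)) k) =
      (\<Prod>k<m. antipodal_factor (a' k) ^ lam k)"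
    by (intro prod.cong) auto
  hence pr: "(\<Prod>k<Suc m. antipodal_factor ((a'(m := a)) k) ^ (lam(m := 1)) k) =
      (\<Prod>k<m. antipodal_factor (a' k) ^ lam k) * antipodal_factor a"
    by (simp only: prod.lessThan_Suc fun_upd_same power_one_right)
  have "(\<Sum>k<m. int ((lam(m := 1)) k)) = (\<Sum>k<m. int (lam k))"
    by (intro sum.cong) auto
  hence sm: "(\<Sum>k<Suc m. int ((lam(m := 1)) k)) = (\<Sum>k<m. int (lam k)) + 1"
    by (simp only: sum.lessThan_Suc fun_upd_same of_nat_1)
  show ?thesis
  proof (rule antipodal_formI[of "Suc m" "a'(m := a)" "lam(m := 1)" n b mu "p - 1" _ C])
    show "R * (antipodal_factor a / to_fract [:0, 1:]) = to_fract [:of_real C:] * to_fract [:0, 1:] powi (p - 1) *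
            ((\<Prod>k<Suc m. antipodal_factor ((a'(m := a)) k) ^ (lam(m := 1)) k) /
             (\<Prod>l<n. antipodal_factor (b l) ^ mu l))"
      unfolding X_def[symmetric] R pr Xp by (simp only: times_divide_eq_left times_divide_eq_right mult_ac)
  qed (use nz assms(2) sum sm in \<open>auto simp: less_Suc_eq\<close>)
qed

lemma antipodal_form_divide_factor:
  assumes "antipodal_form R" "a \<noteq> 0"
  shows "antipodal_form (R / (antipodal_factor a / to_fract [:0, 1:]))"
proof (rule antipodal_formE[OF assms(1)])
  fix C :: real and p :: int and m :: nat and n :: nat and a' :: "nat \<Rightarrow> complex" and b :: "nat \<Rightarrow> complex" and lam :: "nat \<Rightarrow> nat" and mu :: "nat \<Rightarrow> nat"
  assume
      nz: "\<forall>k<m. a' k \<noteq> 0 \<and> lam k > 0" "\<forall>l<n. b l \<noteq> 0 \<and> mu l > 0"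
    and sum: "(\<Sum>l<n. int (mu l)) = p + (\<Sum>k<m. int (lam k))"
    and R': "R = to_fract [:of_real C:] * to_fract [:0, 1:] powi p *
            ((\<Prod>k<m. antipodal_factor (a' k) ^ lam k) /
             (\<Prod>l<n. antipodal_factor (b l) ^ mu l))"
  define X :: "complex poly fract" where "X = to_fract [:0, 1:]"
  have X: "X \<noteq> 0" by (simp add: X_def)
  note R = R'[folded X_def]
  have Xp: "X powi (p + 1) = X powi p * X" by (subst power_int_add) (use X in auto)
  have "(\<Prod>l<n. antipodal_factor ((b(n := a)) l) ^ (mu(n := 1)) l) =
      (\<Prod>l<n. antipodal_factor (b l) ^ mu l)"
    by (intro prod.cong) auto
  hence pr: "(\<Prod>l<Suc n. antipodal_factor ((b(n := a)) l) ^ (mu(n := 1)) l) =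
      (\<Prod>l<n. antipodal_factor (b l) ^ mu l) * antipodal_factor a"
    by (simp only: prod.lessThan_Suc fun_upd_same power_one_right)
  have "(\<Sum>l<n. int ((mu(n := 1)) l)) = (\<Sum>l<n. int (mu l))"
    by (intro sum.cong) auto
  hence sm: "(\<Sum>l<Suc n. int ((mu(n := 1)) l)) = (\<Sum>l<n. int (mu l)) + 1"
    by (simp only: sum.lessThan_Suc fun_upd_same of_nat_1)
  show ?thesis
  proof (rule antipodal_formI[of m a' lam "Suc n" "b(n := a)" "mu(n := 1)" "p + 1" _ C])
    show "R / (antipodal_factor a / to_fract [:0, 1:]) = to_fract [:of_real C:] * to_fract [:0, 1:] powi (p + 1) *
            ((\<Prod>k<m. antipodal_factor (a' k) ^ lam k) /
             (\<Prod>l<Suc n. antipodal_factor ((b(n := a)) l) ^ (mu(n := 1)) l))"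
      unfolding X_def[symmetric] R pr Xp
      by (simp only: divide_divide_eq_right divide_divide_eq_left times_divide_eq_left times_divide_eq_right mult_ac)
  qed (use nz assms(2) sum sm in \<open>auto simp: less_Suc_eq\<close>)
qed

text \<open>From \<open>p' * q = p * q'\<close> and coprimality, \<open>p'\<close> divides
  \<open>p\<close> and \<open>q'\<close> divides \<open>q\<close>. The quotient formed in the
  induction below need not be in lowest terms, and this shows that reducing it cannot undo the
  decrease of the degree.\<close>

lemma degree_quot_of_fract_le:
  fixes p q :: "complex poly"
  assumes "p \<noteq> 0" "q \<noteq> 0"
  defines "R \<equiv> to_fract p / to_fract q"
  shows "degree (fst (quot_of_fract R)) \<le> degree p" "degree (snd (quot_of_fract R)) \<le> degree q"
proof -
  define p' q' where "p' = fst (quot_of_fract R)" and "q' = snd (quot_of_fract R)"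
  have q': "q' \<noteq> 0" by (simp add: q'_def)
  have cop: "coprime p' q'" unfolding p'_def q'_def by (rule coprime_quot_of_fract)
  have "to_fract p' / to_fract q' = to_fract p / to_fract q"
    unfolding p'_def q'_def by (simp only: ratfun_eq_quot[symmetric]) (simp add: R_def)
  hence "to_fract (p' * q) = to_fract (p * q')"
    using assms q' by (simp add: field_simps)
  hence eq: "p' * q = p * q'" by (simp only: to_fract_eq_iff)
  have "p' dvd p" using cop eq by (metis coprime_dvd_mult_left_iff dvd_triv_left)
  moreover have "q' dvd q" using cop eq by (metis coprime_commute coprime_dvd_mult_right_iff dvd_triv_right)
  ultimately show "degree (fst (quot_of_fract R)) \<le> degree p" "degree (snd (quot_of_fract R)) \<le> degree q"
    using assms dvd_imp_degree_le unfolding p'_def q'_def by blast+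
qed

text \<open>After the full power of \<open>w\<close> is split off, no root is left at all, and the
  fundamental theorem of algebra makes the cofactor constant.\<close>

lemma poly_without_nonzero_roots:
  fixes p :: "complex poly"
  assumes "p \<noteq> 0" "\<And>a. a \<noteq> 0 \<Longrightarrow> poly p a \<noteq> 0"
  obtains c n where "c \<noteq> 0" "p = monom c n"
proof -
  obtain n r where r: "p = [:0, 1:] ^ n * r" "\<not> [:0, 1:] dvd r"
  proof -
    obtain r where "p = [:- 0, 1:] ^ Polynomial.order 0 p * r" "\<not> [:- 0, 1:] dvd r"
      using order_decomp[OF assms(1)] by metis
    thus ?thesis using that unfolding minus_zero by metis
  qed
  have "poly r a \<noteq> 0" for a
  proof (cases "a = 0")
    case True
    thus ?thesis using r(2) by (simp add: poly_eq_0_iff_dvd)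
  next
    case False
    thus ?thesis using assms(2) r(1) by auto
  qed
  hence "constant (poly r)" using Fundamental_Theorem_Algebra.fundamental_theorem_of_algebra[of r] by metis
  hence "degree r = 0" by (simp add: constant_degree)
  then obtain c where c: "r = [:c:]" by (metis degree_eq_zeroE)
  show thesis
  proof (rule that)
    show "c \<noteq> 0" using c r by auto
    show "p = monom c n" using r(1) c by (simp add: monom_altdef mult.commute)
  qed
qed

text \<open>A fixed point of the antipodal map would satisfy \<open>a * cnj a = - 1\<close>, which
  is impossible for a squared modulus. Hence the two roots differ and both linear factors divide
  \<open>p\<close>, even when \<open>p\<close> has simple roots there.\<close>

lemma antipodal_factor_dvd:
  assumes "a \<noteq> 0" "poly p a = 0" "poly p (- 1 / cnj a) = 0"
  obtains r where "p = [:-a, 1:] * [:1, cnj a:] * r"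
proof -
  obtain s where s: "p = [:-a, 1:] * s" using assms(2) by (auto simp: poly_eq_0_iff_dvd)
  have "- 1 / cnj a \<noteq> a"
  proof
    assume "- 1 / cnj a = a"
    hence "a * cnj a = - 1" using assms(1) by (simp add: field_simps)
    hence "Re (a * cnj a) = - 1" by simp
    hence "(Re a)\<^sup>2 + (Im a)\<^sup>2 = - 1" by (simp add: power2_eq_square)
    thus False using sum_power2_ge_zero[of "Re a" "Im a"] by linarith
  qed
  moreover have "(- 1 / cnj a - a) * poly s (- 1 / cnj a) = 0" using assms(3) s by (simp add: algebra_simps)
  ultimately have "poly s (- 1 / cnj a) = 0" by simp
  hence "[:1 / cnj a, 1:] dvd s" by (simp add: poly_eq_0_iff_dvd)
  hence "smult (cnj a) [:1 / cnj a, 1:] dvd s" using assms(1) by (intro smult_dvd) auto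
  hence "[:1, cnj a:] dvd s" using assms(1) by simp
  then obtain r where "s = [:1, cnj a:] * r" by (rule dvdE)
  hence "p = [:-a, 1:] * [:1, cnj a:] * r" using s by (simp only: mult.assoc)
  thus thesis by (rule that)
qed

lemma antipodal_factor_nonzero: "antipodal_factor a \<noteq> 0"
proof -
  have "[:-a, 1:] \<noteq> 0" "[:1, cnj a:] \<noteq> 0" by simp_all
  thus ?thesis unfolding antipodal_factor_def to_fract_eq_0_iff by (metis mult_eq_0_iff)
qed

lemma degree_antipodal_factor_mult:
  assumes "a \<noteq> 0" "r \<noteq> 0"
  shows "degree ([:-a, 1:] * [:1, cnj a:] * r) = degree r + 2"
proof -
  have nz: "[:-a, 1:] \<noteq> 0" "[:1, cnj a:] \<noteq> 0" by simp_all
  hence nz': "[:-a, 1:] * [:1, cnj a:] \<noteq> 0" by (metis mult_eq_0_iff)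
  show ?thesis
    unfolding degree_mult_eq[OF nz' assms(2)] degree_mult_eq[OF nz] using assms(1) by simp
qed

lemma ratfun_eval_eq_0_iff:
  "ratfun_eval R (Some w) = Some 0 \<longleftrightarrow> poly (fst (quot_of_fract R)) w = 0"
  using coprime_poly_0[OF coprime_quot_of_fract[of R], of w]
  by (auto simp: ratfun_eval_def case_prod_unfold Let_def split: if_splits)

lemma ratfun_eval_eq_None_iff:
  "ratfun_eval R (Some w) = None \<longleftrightarrow> poly (snd (quot_of_fract R)) w = 0"
  by (auto simp: ratfun_eval_def case_prod_unfold Let_def split: if_splits)

text \<open>A zero or pole other than \<open>0\<close> and infinity comes with its antipode, and dividing the pair off
  lowers the degree; what remains is a monomial, which symmetry forces to be a real constant.\<close>

lemma antipodal_symmetric_imp_form: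
  "antipodal_symmetric R \<Longrightarrow> antipodal_form R"
proof (induction "degree (fst (quot_of_fract R)) + degree (snd (quot_of_fract R))"
    arbitrary: R rule: less_induct)
  case less
  define p q where "p = fst (quot_of_fract R)" and "q = snd (quot_of_fract R)"
  have R: "R = to_fract p / to_fract q" unfolding p_def q_def by (rule ratfun_eq_quot)
  have q: "q \<noteq> 0" by (simp add: q_def)
  note anti = ratfun_eval_antipode[OF less.prems]
  have form_real: "antipodal_form (to_fract [:of_real C:])" for C
    by (rule antipodal_formI[of 0 _ _ 0 _ _ 0 _ C]) auto
  consider "p = 0" | "p \<noteq> 0" "\<exists>a. a \<noteq> 0 \<and> poly p a = 0" | "p \<noteq> 0" "\<exists>a. a \<noteq> 0 \<and> poly q a = 0"
    | "p \<noteq> 0" "\<And>a. a \<noteq> 0 \<Longrightarrow> poly p a \<noteq> 0" "\<And>a. a \<noteq> 0 \<Longrightarrow> poly q a \<noteq> 0" by blast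
  thus ?case
  proof cases
    case 1
    hence "R = to_fract [:of_real 0:]" using R by simp
    thus ?thesis using form_real by metis
  next
    case 2
    then obtain a where a: "a \<noteq> 0" "poly p a = 0" by blast
    have "ratfun_eval R (Some a) = Some 0" using a by (simp add: ratfun_eval_eq_0_iff p_def)
    hence "ratfun_eval R (Some (- 1 / cnj a)) = Some 0"
      using anti[of "Some a"] a by (simp add: sphere_antipode_def)
    hence "poly p (- 1 / cnj a) = 0" by (simp only: ratfun_eval_eq_0_iff p_def)
    then obtain r where r: "p = [:-a, 1:] * [:1, cnj a:] * r"
      using antipodal_factor_dvd a by blast
    have r0: "r \<noteq> 0" using r 2 by auto
    \<comment> \<open>The division takes two off the degree of the numerator and the factor
      \<open>[:0, 1:]\<close> gives one back, so the measure drops by at least one.\<close>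
    define S where "S = R / (antipodal_factor a / to_fract [:0, 1:])"
    note fa = antipodal_factor_nonzero[of a]
    have "S = (antipodal_factor a * to_fract r / to_fract q) / (antipodal_factor a / to_fract [:0,1:])"
      unfolding S_def R r antipodal_factor_def by (simp only: to_fract_mult)
    also have "\<dots> = to_fract (r * [:0, 1:]) / to_fract q" using fa by (simp only: to_fract_mult) simp
    finally have S: "S = to_fract (r * [:0, 1:]) / to_fract q" .
    have rX: "r * [:0, 1:] \<noteq> 0" using r0 by simp
    have dp: "degree p = degree r + 2" unfolding r by (rule degree_antipodal_factor_mult[OF a(1) r0])
    have dr: "degree (r * [:0, 1:]) = degree r + 1" using r0
      by (subst degree_mult_eq) auto
    have "antipodal_form S"
    proof (rule less.hyps)
      show "degree (fst (quot_of_fract S)) + degree (snd (quot_of_fract S)) < degree (fst (quot_of_fract R)) + degree (snd (quot_of_fract R))"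
        using degree_quot_of_fract_le[OF rX q] dp dr unfolding S p_def[symmetric] q_def[symmetric] by linarith
      show "antipodal_symmetric S" unfolding S_def
        by (rule antipodal_symmetric_divide[OF less.prems antipodal_symmetric_factor])
    qed
    from antipodal_form_times_factor[OF this a(1)] show ?thesis
      unfolding S_def using fa by simp
  next
    case 3
    then obtain a where a: "a \<noteq> 0" "poly q a = 0" by blast
    have "ratfun_eval R (Some a) = None" using a by (simp add: ratfun_eval_eq_None_iff q_def)
    hence "ratfun_eval R (Some (- 1 / cnj a)) = None"
      using anti[of "Some a"] a by (simp add: sphere_antipode_def)
    hence "poly q (- 1 / cnj a) = 0" by (simp only: ratfun_eval_eq_None_iff q_def)
    then obtain r where r: "q = [:-a, 1:] * [:1, cnj a:] * r"
      using antipodal_factor_dvd a by blast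
    have r0: "r \<noteq> 0" using r q by auto
    define S where "S = R * (antipodal_factor a / to_fract [:0, 1:])"
    note fa = antipodal_factor_nonzero[of a]
    have "S = (to_fract p / (antipodal_factor a * to_fract r)) * (antipodal_factor a / to_fract [:0,1:])"
      unfolding S_def R r antipodal_factor_def by (simp only: to_fract_mult)
    also have "\<dots> = to_fract p / to_fract (r * [:0, 1:])" using fa by (simp only: to_fract_mult) simp
    finally have S: "S = to_fract p / to_fract (r * [:0, 1:])" .
    have rX: "r * [:0, 1:] \<noteq> 0" using r0 by simp
    have dp: "degree q = degree r + 2" unfolding r by (rule degree_antipodal_factor_mult[OF a(1) r0])
    have dr: "degree (r * [:0, 1:]) = degree r + 1" using r0
      by (subst degree_mult_eq) auto
    have "antipodal_form S"
    proof (rule less.hyps)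
      show "degree (fst (quot_of_fract S)) + degree (snd (quot_of_fract S)) < degree (fst (quot_of_fract R)) + degree (snd (quot_of_fract R))"
        using degree_quot_of_fract_le[OF 3(1) rX] dp dr unfolding S p_def[symmetric] q_def[symmetric] by linarith
      show "antipodal_symmetric S" unfolding S_def
        by (rule antipodal_symmetric_mult[OF less.prems antipodal_symmetric_factor])
    qed
    from antipodal_form_divide_factor[OF this a(1)] show ?thesis
      unfolding S_def using fa by simp
  next
    case 4
    obtain c n where c: "c \<noteq> 0" "p = monom c n" using poly_without_nonzero_roots[of p] 4 by metis
    obtain d m where d: "d \<noteq> 0" "q = monom d m" using poly_without_nonzero_roots[of q] 4 q by metis
    have ev: "eventually (\<lambda>w. ratfun_val R w = c * w ^ n / (d * w ^ m)) cofinite"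
      using ratfun_val_Fract[OF q, of p] unfolding R[symmetric] by (simp add: poly_monom c(2) d(2))
    have nz: "eventually (\<lambda>w::complex. w \<noteq> 0) cofinite"
      by (simp add: eventually_cofinite)
    define K where "K = c / d"
    have K0: "K \<noteq> 0" using c d by (simp add: K_def)
    \<comment> \<open>This is the symmetry of \<open>K * w ^ n / w ^ m\<close> with all powers of
      \<open>w\<close> cleared. Comparing degrees gives \<open>n = m\<close>; then the signs agree
      and \<open>K\<close> equals its conjugate.\<close>
    have "eventually (\<lambda>w. poly (monom (K * (-1) ^ m) (2 * n)) w = poly (monom (cnj K * (-1) ^ n) (2 * m)) w) cofinite"
      using less.prems[unfolded antipodal_symmetric_def] ev eventually_cofinite_antipode[OF ev] nz
    proof eventually_elim
      case (elim w)
      have "K * w ^ n / w ^ m = cnj K * (- 1 / w) ^ n / (- 1 / w) ^ m"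
        using elim by (simp add: K_def)
      hence E: "K * w ^ n * (- 1 / w) ^ m = cnj K * (- 1 / w) ^ n * w ^ m"
        using elim(4) by (simp add: field_simps)
      have pw: "(- 1 / w) ^ k * w ^ k = (- 1) ^ k" for k
        using elim(4) by (simp flip: power_mult_distrib)
      have "K * w ^ n * (- 1 / w) ^ m * (w ^ m * w ^ n) = cnj K * (- 1 / w) ^ n * w ^ m * (w ^ m * w ^ n)"
        by (simp only: E)
      hence "K * w ^ n * ((- 1 / w) ^ m * w ^ m) * w ^ n = cnj K * ((- 1 / w) ^ n * w ^ n) * w ^ m * w ^ m"
        by (simp only: mult_ac)
      hence "K * w ^ n * (- 1) ^ m * w ^ n = cnj K * (- 1) ^ n * w ^ m * w ^ m"
        unfolding pw .
      thus ?case by (simp add: poly_monom power_add mult_2 mult_2_right mult_ac)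
    qed
    hence "finite (- {w. poly (monom (K * (-1) ^ m) (2 * n)) w = poly (monom (cnj K * (-1) ^ n) (2 * m)) w})"
      by (simp add: eventually_cofinite Compl_eq)
    hence "infinite {w. poly (monom (K * (-1) ^ m) (2 * n)) w = poly (monom (cnj K * (-1) ^ n) (2 * m)) w}"
      using infinite_UNIV_char_0[where 'a = complex] by (metis finite_compl)
    hence eq: "monom (K * (-1) ^ m) (2 * n) = monom (cnj K * (-1) ^ n) (2 * m)"
      by (rule poly_eq_of_infinite) auto
    have "degree (monom (K * (-1) ^ m) (2 * n)) = 2 * n" "degree (monom (cnj K * (-1) ^ n) (2 * m)) = 2 * m"
      using K0 by (simp_all add: degree_monom_eq)
    hence nm: "n = m" using eq by simp
    with eq have "K = cnj K" by simp
    then obtain C where C: "K = of_real C" by (metis Reals_cnj_iff Reals_cases)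
    have "p = smult K q" unfolding c(2) d(2) using nm d(1) by (simp add: smult_monom K_def)
    hence "p = [:K:] * q" by simp
    hence "R = to_fract [:of_real C:]" unfolding R using q C by (simp only: to_fract_mult) simp
    thus ?thesis using form_real by simp
  qed
qed

section \<open>The Weierstrass function of a square lattice\<close>

text \<open>The exponent is half of 3: the sum of inverse cubes over the lattice will be bounded by
  a product of two such sums over the integers.\<close>

lemma summable_on_int_power_three_halves:
  "(\<lambda>m::int. (1 + real_of_int \<bar>m\<bar>) powr (-3/2)) summable_on UNIV"
proof -
  let ?g = "\<lambda>m::int. (1 + real_of_int \<bar>m\<bar>) powr (-3/2)"
  have s: "summable (\<lambda>n. real (Suc n) powr (-3/2))"
    using summable_real_powr_iff[of "-3/2"] by (subst summable_Suc_iff) simp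
  have nat: "(\<lambda>n::nat. (1 + real n) powr (-3/2)) summable_on UNIV"
    using s by (subst summable_on_UNIV_nonneg_real_iff) (simp_all add: add.commute)
  have nat': "(\<lambda>n::nat. (1 + real (Suc n)) powr (-3/2)) summable_on UNIV"
    using s by (subst summable_on_UNIV_nonneg_real_iff)
      (use summable_Suc_iff[of "\<lambda>n. real (Suc n) powr (-3/2)"] in \<open>simp_all add: add_ac\<close>)
  have "inj (\<lambda>n. - int (Suc n))" by (auto simp: inj_on_def)
  hence "?g summable_on range (\<lambda>n. - int (Suc n))"
    using nat' by (subst summable_on_reindex) (simp_all add: o_def)
  moreover have "?g summable_on range int"
    using nat by (subst summable_on_reindex) (simp_all add: o_def)
  moreover have "range int \<inter> range (\<lambda>n. - int (Suc n)) = {}" by auto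
  ultimately have "?g summable_on (range int \<union> range (\<lambda>n. - int (Suc n)))"
    by (intro summable_on_Un_disjoint)
  also have "range int \<union> range (\<lambda>n. - int (Suc n)) = UNIV"
  proof -
    have "m \<in> range int \<union> range (\<lambda>n. - int (Suc n))" for m
      by (cases m) auto
    thus ?thesis by blast
  qed
  finally show ?thesis .
qed

lemma analytic_divided_difference:
  assumes "f analytic_on {a}"
  shows "(\<lambda>z. if z = a then deriv f a else (f z - f a) / (z - a)) analytic_on {a}"
proof -
  obtain e where e: "e > 0" "f holomorphic_on ball a e"
    using assms analytic_at_ball by blast
  hence "(\<lambda>z. if z = a then deriv f a else (f z - f a) / (z - a)) holomorphic_on ball a e"
    by (intro pole_lemma) auto
  thus ?thesis using e(1) analytic_at_ball by blast
qed

text \<open>Evenness makes the first divided difference \<open>u1\<close> odd near 0, so it vanishes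
  there and the zero of \<open>u\<close> is at least double. The limit is the value at 0 of the
  second divided difference.\<close>

lemma even_analytic_zero_limit:
  fixes u :: "complex \<Rightarrow> complex"
  assumes u: "u analytic_on {0}" "u 0 = 0" and even: "eventually (\<lambda>z. u (- z) = u z) (at 0)"
  shows "\<exists>l. ((\<lambda>z. u z / z ^ 2) \<longlongrightarrow> l) (at 0)"
proof -
  define u1 where "u1 = (\<lambda>z. if z = 0 then deriv u 0 else (u z - u 0) / (z - 0))"
  define u2 where "u2 = (\<lambda>z. if z = 0 then deriv u1 0 else (u1 z - u1 0) / (z - 0))"
  have a1: "u1 analytic_on {0}" unfolding u1_def by (rule analytic_divided_difference[OF u(1)])
  have a2: "u2 analytic_on {0}" unfolding u2_def by (rule analytic_divided_difference[OF a1])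
  have l1: "(u1 \<longlongrightarrow> u1 0) (at 0)"
    using analytic_at_imp_isCont[OF a1] by (simp add: isCont_def)
  moreover have "filterlim (\<lambda>z::complex. - z) (at 0) (at 0)"
    by (auto simp: filterlim_at eventually_at_filter intro!: tendsto_eq_intros)
  ultimately have "((\<lambda>z. u1 (- z)) \<longlongrightarrow> u1 0) (at 0)"
    by (rule filterlim_compose)
  moreover have "eventually (\<lambda>z. u1 (- z) = - u1 z) (at 0)"
    using even eventually_neq_at_within[of 0] by eventually_elim (simp add: u1_def u(2))
  ultimately have "((\<lambda>z. - u1 z) \<longlongrightarrow> u1 0) (at 0)"
    by (rule Lim_transform_eventually)
  moreover have "((\<lambda>z. - u1 z) \<longlongrightarrow> - u1 0) (at 0)" using l1 by (rule tendsto_minus)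
  ultimately have "u1 0 = - u1 0" using tendsto_unique[OF at_neq_bot] by blast
  hence z: "u1 0 = 0" by simp
  have "(u2 \<longlongrightarrow> u2 0) (at 0)"
    using analytic_at_imp_isCont[OF a2] by (simp add: isCont_def)
  moreover have "eventually (\<lambda>z. u2 z = u z / z ^ 2) (at 0)"
    using eventually_neq_at_within[of 0]
    by eventually_elim (simp add: u2_def z, simp add: u1_def u(2) power2_eq_square)
  ultimately have "((\<lambda>z. u z / z ^ 2) \<longlongrightarrow> u2 0) (at 0)" by (rule Lim_transform_eventually)
  thus ?thesis by blast
qed

section \<open>The square lattice and convergence of the Weierstrass sum\<close>

locale square_weierstrass =
  fixes \<alpha> :: real
  assumes alpha_pos: "\<alpha> > 0"
begin

definition L :: "complex set" where "L = square_lattice \<alpha>"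

text \<open>At lattice points the value is a finite artefact of \<open>1 / 0 = 0\<close>. The
  symmetries proved below hold there too, because reindexing the sum respects that convention, so
  they need no case distinction.\<close>

definition wp :: "complex \<Rightarrow> complex" where "wp = weierstrass_val L"

text \<open>Since \<open>1 / 0 = 0\<close>, the term for \<open>\<omega> = 0\<close> is \<open>1 / z\<^sup>2\<close>, and \<open>wp\<close> is the sum of \<open>wterm\<close> over the
  whole lattice.\<close>

definition wterm :: "complex \<Rightarrow> complex \<Rightarrow> complex" where
  "wterm z \<omega> = 1 / (z - \<omega>) ^ 2 - 1 / \<omega> ^ 2"

lemma L_iff: "z \<in> L \<longleftrightarrow> (\<exists>m n. z = Complex (of_int m * \<alpha>) (of_int n * \<alpha>))"
  unfolding L_def square_lattice_def by (auto simp: complex_eq_iff)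

lemma L_I: "Complex (of_int m * \<alpha>) (of_int n * \<alpha>) \<in> L"
  by (auto simp: L_iff)

lemma L_E:
  assumes "z \<in> L"
  obtains m n where "z = Complex (of_int m * \<alpha>) (of_int n * \<alpha>)"
  using assms by (auto simp: L_iff)

lemma zero_in_L [simp]: "0 \<in> L"
  using L_I[of 0 0] by (simp add: zero_complex.code)

lemma L_add: "x \<in> L \<Longrightarrow> y \<in> L \<Longrightarrow> x + y \<in> L"
proof -
  assume "x \<in> L" "y \<in> L"
  then obtain m n m' n' where "x = Complex (of_int m * \<alpha>) (of_int n * \<alpha>)" "y = Complex (of_int m' * \<alpha>) (of_int n' * \<alpha>)"
    unfolding L_iff by auto
  hence "x + y = Complex (of_int (m + m') * \<alpha>) (of_int (n + n') * \<alpha>)"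
    by (simp add: complex_eq_iff algebra_simps)
  thus ?thesis by (simp only: L_I)
qed

lemma L_uminus: "x \<in> L \<Longrightarrow> - x \<in> L"
proof -
  assume "x \<in> L"
  then obtain m n where "x = Complex (of_int m * \<alpha>) (of_int n * \<alpha>)" by (rule L_E)
  hence "- x = Complex (of_int (- m) * \<alpha>) (of_int (- n) * \<alpha>)" by (simp add: complex_eq_iff)
  thus ?thesis by (simp only: L_I)
qed

lemma L_diff: "x \<in> L \<Longrightarrow> y \<in> L \<Longrightarrow> x - y \<in> L"
  using L_add[of x "- y"] L_uminus[of y] by simp

lemma L_uminus_iff [simp]: "- x \<in> L \<longleftrightarrow> x \<in> L"
  using L_uminus[of x] L_uminus[of "- x"] by auto

lemma L_add_iff: "y \<in> L \<Longrightarrow> x + y \<in> L \<longleftrightarrow> x \<in> L"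
  using L_add[of x y] L_diff[of "x + y" y] by auto

lemma L_mult_i: "x \<in> L \<Longrightarrow> \<i> * x \<in> L"
proof -
  assume "x \<in> L"
  then obtain m n where "x = Complex (of_int m * \<alpha>) (of_int n * \<alpha>)" by (rule L_E)
  hence "\<i> * x = Complex (of_int (- n) * \<alpha>) (of_int m * \<alpha>)" by (simp add: complex_eq_iff)
  thus ?thesis by (simp only: L_I)
qed

lemma L_mult_i_iff [simp]: "\<i> * x \<in> L \<longleftrightarrow> x \<in> L"
proof
  assume "\<i> * x \<in> L"
  hence "- (\<i> * (\<i> * x)) \<in> L" by (rule L_uminus[OF L_mult_i])
  moreover have "- (\<i> * (\<i> * x)) = x" by (simp add: complex_eq_iff)
  ultimately show "x \<in> L" by metis
qed (rule L_mult_i)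

lemma L_cnj: "x \<in> L \<Longrightarrow> cnj x \<in> L"
proof -
  assume "x \<in> L"
  then obtain m n where "x = Complex (of_int m * \<alpha>) (of_int n * \<alpha>)" by (rule L_E)
  hence "cnj x = Complex (of_int m * \<alpha>) (of_int (- n) * \<alpha>)" by (simp add: complex_eq_iff)
  thus ?thesis by (simp only: L_I)
qed

lemma L_cnj_iff [simp]: "cnj x \<in> L \<longleftrightarrow> x \<in> L"
  using L_cnj[of x] L_cnj[of "cnj x"] by auto

lemma alpha_in_L: "of_real \<alpha> \<in> L" "of_real \<alpha> * \<i> \<in> L"
  using L_I[of 1 0] L_I[of 0 1] by (simp_all add: complex_eq_iff L_iff)

lemma half_notin_L:
  assumes "x \<in> {1, \<i>, 1 + \<i>}"
  shows "of_real \<alpha> * x / 2 \<notin> L"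
proof
  assume "of_real \<alpha> * x / 2 \<in> L"
  then obtain m n where *: "of_real \<alpha> * x / 2 = Complex (of_int m * \<alpha>) (of_int n * \<alpha>)" by (rule L_E)
  have "Re (of_real \<alpha> * x / 2) = of_int m * \<alpha>" "Im (of_real \<alpha> * x / 2) = of_int n * \<alpha>"
    unfolding * by simp_all
  hence "Re x = 2 * of_int m" "Im x = 2 * of_int n" using alpha_pos by (simp_all add: field_simps)
  hence "of_int (2 * m) = (1::real) \<or> of_int (2 * n) = (1::real)" using assms by auto
  hence "2 * m = 1 \<or> 2 * n = 1" by linarith
  thus False by presburger
qed

lemma norm_L_ge: "norm (Complex (of_int m * \<alpha>) (of_int n * \<alpha>)) \<ge> \<alpha> * of_int (max \<bar>m\<bar> \<bar>n\<bar>)"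
  using abs_Re_le_cmod[of "Complex (of_int m * \<alpha>) (of_int n * \<alpha>)"]
        abs_Im_le_cmod[of "Complex (of_int m * \<alpha>) (of_int n * \<alpha>)"] alpha_pos
  by (simp add: abs_mult max_def mult.commute)

lemma finite_L_cball: "finite (L \<inter> cball 0 r)"
proof -
  define N where "N = \<lceil>r / \<alpha>\<rceil>"
  have "L \<inter> cball 0 r \<subseteq> (\<lambda>(m, n). Complex (of_int m * \<alpha>) (of_int n * \<alpha>)) ` ({- N..N} \<times> {- N..N})"
  proof
    fix x assume x: "x \<in> L \<inter> cball 0 r"
    then obtain m n where mn: "x = Complex (of_int m * \<alpha>) (of_int n * \<alpha>)" using L_iff by auto
    have "\<alpha> * of_int (max \<bar>m\<bar> \<bar>n\<bar>) \<le> r" using norm_L_ge[of m n] x mn by simp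
    hence "of_int (max \<bar>m\<bar> \<bar>n\<bar>) \<le> r / \<alpha>" using alpha_pos by (simp add: field_simps)
    hence "max \<bar>m\<bar> \<bar>n\<bar> \<le> N" unfolding N_def by linarith
    hence "(m, n) \<in> {- N..N} \<times> {- N..N}" by auto
    thus "x \<in> (\<lambda>(m, n). Complex (of_int m * \<alpha>) (of_int n * \<alpha>)) ` ({- N..N} \<times> {- N..N})"
      using mn by force
  qed
  thus ?thesis by (rule finite_subset) auto
qed

text \<open>Let \<open>M\<close> be the larger of the two absolute coordinates. Then
  \<open>norm \<omega> \<ge> \<alpha> * M\<close>, and for \<open>M \<ge> 1\<close> the product
  \<open>(1 + |m|) * (1 + |n|)\<close> is at most \<open>(2 * M) ^ 2\<close>. The comparison series
  thus factorises over \<open>m\<close> and \<open>n\<close>, and the 8 is the cube of that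
  2.\<close>

lemma summable_on_L_cube: "(\<lambda>\<omega>. 1 / norm \<omega> ^ 3) summable_on L"
proof -
  define \<phi> where "\<phi> = (\<lambda>(m, n). Complex (of_int m * \<alpha>) (of_int n * \<alpha>))"
  define g where "g = (\<lambda>m::int. (1 + real_of_int \<bar>m\<bar>) powr (-3/2))"
  have gsum: "g summable_on UNIV" unfolding g_def by (rule summable_on_int_power_three_halves)
  have g0: "g m \<ge> 0" for m by (simp add: g_def)
  have "(\<lambda>(m, n). g m * g n) summable_on (UNIV \<times> UNIV)"
  proof (rule summable_on_SigmaI)
    show "((\<lambda>y. case (m, y) of (m, n) \<Rightarrow> g m * g n) has_sum g m * infsum g UNIV) UNIV" for m
      using gsum by (simp add: has_sum_cmult_right)
    show "(\<lambda>m. g m * infsum g UNIV) summable_on UNIV"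
      using gsum by (rule summable_on_cmult_left)
  qed (use g0 in auto)
  hence "(\<lambda>x. (8 / \<alpha> ^ 3) * (case x of (m, n) \<Rightarrow> g m * g n)) summable_on UNIV"
    by (intro summable_on_cmult_right) simp
  hence "((\<lambda>\<omega>. 1 / norm \<omega> ^ 3) \<circ> \<phi>) summable_on UNIV"
  proof (rule summable_on_comparison_test)
    fix x :: "int \<times> int"
    obtain m n where x: "x = (m, n)" by force
    define M where "M = real_of_int (max \<bar>m\<bar> \<bar>n\<bar>)"
    show "((\<lambda>\<omega>. 1 / norm \<omega> ^ 3) \<circ> \<phi>) x \<le> (8 / \<alpha> ^ 3) * (case x of (m, n) \<Rightarrow> g m * g n)"
    proof (cases "m = 0 \<and> n = 0")
      \<comment> \<open>The origin contributes \<open>1 / 0 = 0\<close>, so it stays in the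
        sum.\<close>
      case True
      thus ?thesis using x alpha_pos g0 by (simp add: \<phi>_def zero_complex.code[symmetric])
    next
      case False
      hence M1: "M \<ge> 1" unfolding M_def by linarith
      have "(1 + real_of_int \<bar>m\<bar>) * (1 + real_of_int \<bar>n\<bar>) \<le> (2 * M) * (2 * M)"
        using M1 unfolding M_def by (intro mult_mono) linarith+
      hence "((1 + real_of_int \<bar>m\<bar>) * (1 + real_of_int \<bar>n\<bar>)) powr (-3/2) \<ge> ((2 * M) * (2 * M)) powr (-3/2)"
        by (intro powr_mono2') (auto intro: mult_pos_pos add_pos_nonneg)
      also have "((1 + real_of_int \<bar>m\<bar>) * (1 + real_of_int \<bar>n\<bar>)) powr (-3/2) = g m * g n"
        unfolding g_def by (subst powr_mult) auto
      also have "((2 * M) * (2 * M)) powr (-3/2) = (2 * M) powr (-3/2) * (2 * M) powr (-3/2)"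
        using M1 by (subst powr_mult) auto
      also have "\<dots> = (2 * M) powr (-3/2 + (-3/2))" by (rule powr_add[symmetric])
      also have "\<dots> = (2 * M) powr (- real 3)" by simp
      also have "\<dots> = 1 / (2 * M) ^ 3" using M1 by (subst powr_minus, subst powr_realpow) (auto simp: field_simps)
      finally have gg: "1 / (2 * M) ^ 3 \<le> g m * g n" .
      have "\<alpha> * M \<le> norm (\<phi> x)" using norm_L_ge[of m n] x by (simp add: \<phi>_def M_def)
      hence "(\<alpha> * M) ^ 3 \<le> norm (\<phi> x) ^ 3" using alpha_pos M1 by (intro power_mono) auto
      hence "1 / norm (\<phi> x) ^ 3 \<le> 1 / (\<alpha> * M) ^ 3" using alpha_pos M1
        by (intro frac_le) auto
      also have "\<dots> = (8 / \<alpha> ^ 3) * (1 / (2 * M) ^ 3)" by (simp add: power_mult_distrib)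
      also have "\<dots> \<le> (8 / \<alpha> ^ 3) * (g m * g n)" using gg alpha_pos by (intro mult_left_mono) auto
      finally show ?thesis using x by simp
    qed
  qed auto
  moreover have "inj \<phi>" using alpha_pos by (auto simp: inj_on_def \<phi>_def)
  ultimately have "(\<lambda>\<omega>. 1 / norm \<omega> ^ 3) summable_on range \<phi>"
    by (subst summable_on_reindex) auto
  also have "range \<phi> = L" by (force simp: \<phi>_def L_iff)
  finally show ?thesis .
qed

text \<open>Over a common denominator the leading terms cancel and one order of decay is gained. The
  constant 10 is 5/2, from the bound on \<open>2 * \<omega> - z\<close>, times 4, from
  \<open>norm (z - \<omega>) \<ge> norm \<omega> / 2\<close> squared.\<close>

lemma norm_wterm_le:
  assumes "r > 0" "norm z \<le> r" "norm \<omega> \<ge> 2 * r"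
  shows "norm (wterm z \<omega>) \<le> (10 * r) * (1 / norm \<omega> ^ 3)"
proof -
  have w0: "norm \<omega> > 0" using assms by linarith
  have d: "norm (z - \<omega>) \<ge> norm \<omega> / 2"
    using assms norm_triangle_ineq2[of \<omega> z] by (simp add: norm_minus_commute)
  hence zw: "z - \<omega> \<noteq> 0" "\<omega> \<noteq> 0" using w0 by auto
  have "wterm z \<omega> = z * (2 * \<omega> - z) / ((z - \<omega>) ^ 2 * \<omega> ^ 2)"
  proof -
    have "wterm z \<omega> = (\<omega> ^ 2 - (z - \<omega>) ^ 2) / ((z - \<omega>) ^ 2 * \<omega> ^ 2)"
      using zw unfolding wterm_def by (subst diff_frac_eq) simp_all
    also have "\<omega> ^ 2 - (z - \<omega>) ^ 2 = z * (2 * \<omega> - z)"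
      by (simp add: power2_eq_square algebra_simps)
    finally show ?thesis .
  qed
  hence "norm (wterm z \<omega>) = norm z * norm (2 * \<omega> - z) / (norm (z - \<omega>) ^ 2 * norm \<omega> ^ 2)"
    by (simp add: norm_mult norm_divide norm_power)
  also have "\<dots> \<le> r * ((5/2) * norm \<omega>) / ((norm \<omega> / 2) ^ 2 * norm \<omega> ^ 2)"
  proof (intro frac_le mult_mono power_mono)
    show "norm (2 * \<omega> - z) \<le> 5/2 * norm \<omega>"
      using norm_triangle_ineq4[of "2 * \<omega>" z] assms by (simp add: norm_mult)
  qed (use assms d w0 in auto)
  also have "\<dots> = (10 * r) * (1 / norm \<omega> ^ 3)"
    using w0 by (simp add: field_simps power2_eq_square power3_eq_cube)
  finally show ?thesis .
qed

text \<open>For these lattice points the bound on \<open>wterm\<close> is uniform in the disc of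
  radius \<open>r\<close>; only finitely many lattice points are left out.\<close>

definition L_far :: "real \<Rightarrow> complex set" where "L_far r = L - cball 0 (2 * r)"

lemma L_far_summable: "(\<lambda>\<omega>. (10 * r) * (1 / norm \<omega> ^ 3)) summable_on L_far r"
  using summable_on_L_cube summable_on_subset_banach[of _ L "L_far r"]
  by (intro summable_on_cmult_right) (auto simp: L_far_def)

lemma wterm_summable_far: "r > 0 \<Longrightarrow> norm z \<le> r \<Longrightarrow> wterm z summable_on L_far r"
  by (rule abs_summable_summable[OF summable_on_comparison_test[OF L_far_summable[of r]]], rule norm_wterm_le)
     (auto simp: L_far_def)

lemma L_split: "L = (L \<inter> cball 0 (2 * r)) \<union> L_far r"
  by (auto simp: L_far_def)

lemma wterm_summable: "wterm z summable_on L"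
proof -
  have "wterm z summable_on ((L \<inter> cball 0 (2 * (norm z + 1))) \<union> L_far (norm z + 1))"
    by (intro summable_on_Un_disjoint wterm_summable_far)
       (auto simp: L_far_def finite_L_cball add_nonneg_pos)
  thus ?thesis using L_split[of "norm z + 1"] by simp
qed

lemma wp_eq: "wp z = infsum (wterm z) L"
proof -
  have L: "L = {0} \<union> (L - {0})" by auto
  have "wterm z summable_on (L - {0})"
    using wterm_summable by (rule summable_on_subset_banach) auto
  hence "infsum (wterm z) ({0} \<union> (L - {0})) = infsum (wterm z) {0} + infsum (wterm z) (L - {0})"
    by (intro infsum_Un_disjoint) auto
  moreover have "infsum (wterm z) {0} = 1 / z ^ 2" by (simp add: wterm_def)
  moreover have "wp z = 1 / z ^ 2 + infsum (wterm z) (L - {0})"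
    unfolding wp_def weierstrass_val_def wterm_def[abs_def] ..
  ultimately show ?thesis using L by metis
qed

text \<open>The far terms have no pole in the disc and converge uniformly by the M-test, so all
  singular behaviour sits in a finite sum.\<close>

lemma wp_holomorphic_part:
  assumes r: "r > 0"
  obtains h where "h holomorphic_on ball 0 r"
    "\<And>z. z \<in> ball 0 r \<Longrightarrow> wp z = (\<Sum>\<omega>\<in>L \<inter> cball 0 (2 * r). wterm z \<omega>) + h z"
proof -
  define h where "h = (\<lambda>z. infsum (wterm z) (L_far r))"
  have ul: "uniform_limit (cball 0 r) (\<lambda>X z. \<Sum>\<omega>\<in>X. wterm z \<omega>) h (finite_subsets_at_top (L_far r))"
    unfolding h_def using r
    by (intro Weierstrass_m_test_general[OF _ L_far_summable[of r]] norm_wterm_le) (auto simp: L_far_def)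
  have hol: "(\<lambda>z. \<Sum>\<omega>\<in>X. wterm z \<omega>) holomorphic_on cball 0 r" if "X \<subseteq> L_far r" for X
    unfolding wterm_def using that
    by (intro holomorphic_intros) (use r in \<open>auto simp: L_far_def\<close>)
  have "eventually (\<lambda>X. finite X \<and> X \<subseteq> L_far r) (finite_subsets_at_top (L_far r))"
    by (rule eventually_finite_subsets_at_top_weakI) auto
  hence ev: "eventually (\<lambda>X. continuous_on (cball 0 r) (\<lambda>z. \<Sum>\<omega>\<in>X. wterm z \<omega>) \<and>
      (\<lambda>z. \<Sum>\<omega>\<in>X. wterm z \<omega>) holomorphic_on ball 0 r) (finite_subsets_at_top (L_far r))"
    by eventually_elim
       (use hol holomorphic_on_imp_continuous_on holomorphic_on_subset[OF _ ball_subset_cball] in blast)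
  have "h holomorphic_on ball 0 r"
    using holomorphic_uniform_limit[OF ev ul finite_subsets_at_top_neq_bot] by blast
  moreover have "wp z = (\<Sum>\<omega>\<in>L \<inter> cball 0 (2 * r). wterm z \<omega>) + h z" if "z \<in> ball 0 r" for z
  proof -
    have "infsum (wterm z) ((L \<inter> cball 0 (2 * r)) \<union> L_far r) =
        infsum (wterm z) (L \<inter> cball 0 (2 * r)) + infsum (wterm z) (L_far r)"
      using that r by (intro infsum_Un_disjoint wterm_summable_far)
        (auto simp: L_far_def finite_L_cball)
    thus ?thesis unfolding wp_eq h_def using L_split[of r] finite_L_cball by simp
  qed
  ultimately show thesis by (rule that)
qed

lemma wp_analytic:
  assumes "z \<notin> L"
  shows "wp analytic_on {z}"
proof -
  obtain h where h: "h holomorphic_on ball 0 (norm z + 1)"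
    "\<And>x. x \<in> ball 0 (norm z + 1) \<Longrightarrow> wp x = (\<Sum>\<omega>\<in>L \<inter> cball 0 (2 * (norm z + 1)). wterm x \<omega>) + h x"
    using wp_holomorphic_part[of "norm z + 1"] by (auto simp: add_nonneg_pos)
  have zb: "z \<in> ball 0 (norm z + 1)" by simp
  have "h analytic_on {z}" using h(1) zb analytic_at by blast
  hence "(\<lambda>x. (\<Sum>\<omega>\<in>L \<inter> cball 0 (2 * (norm z + 1)). wterm x \<omega>) + h x) analytic_on {z}"
    unfolding wterm_def using assms by (intro analytic_intros) auto
  moreover have "eventually (\<lambda>x. x \<in> ball 0 (norm z + 1)) (nhds z)"
    using zb by (intro eventually_nhds_in_open) auto
  hence ev: "eventually (\<lambda>x. wp x = (\<Sum>\<omega>\<in>L \<inter> cball 0 (2 * (norm z + 1)). wterm x \<omega>) + h x) (nhds z)"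
    by eventually_elim (rule h(2))
  ultimately show ?thesis using analytic_at_cong[OF ev refl] by simp
qed

text \<open>The term of the origin is exactly \<open>1 / z ^ 2\<close>; the other near terms and the
  far part are analytic at 0 and disappear after multiplication by \<open>z ^ 2\<close>.\<close>

lemma wp_double_pole: "((\<lambda>z. z ^ 2 * wp z) \<longlongrightarrow> 1) (at 0)"
proof -
  obtain h where h: "h holomorphic_on ball 0 1"
    "\<And>x. x \<in> ball 0 1 \<Longrightarrow> wp x = (\<Sum>\<omega>\<in>L \<inter> cball 0 (2 * 1). wterm x \<omega>) + h x"
    using wp_holomorphic_part[of 1] by auto
  define F where "F = L \<inter> cball 0 (2 * 1) - {0}"
  have F: "finite F" unfolding F_def using finite_L_cball by blast
  have sumF: "(\<Sum>\<omega>\<in>L \<inter> cball 0 (2 * 1). wterm x \<omega>) = 1 / x ^ 2 + (\<Sum>\<omega>\<in>F. wterm x \<omega>)" for x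
    unfolding F_def using finite_L_cball by (subst sum.remove[of _ 0]) (auto simp: wterm_def)
  have "h analytic_on {0}" using h(1) analytic_at[of h 0] by force
  hence "(\<lambda>x. (\<Sum>\<omega>\<in>F. wterm x \<omega>) + h x) analytic_on {0}"
    unfolding wterm_def F_def by (intro analytic_intros) auto
  hence "((\<lambda>x. (\<Sum>\<omega>\<in>F. wterm x \<omega>) + h x) \<longlongrightarrow> (\<Sum>\<omega>\<in>F. wterm 0 \<omega>) + h 0) (at 0)"
    using analytic_at_imp_isCont isCont_def by blast
  from tendsto_add[OF tendsto_const tendsto_mult[OF tendsto_power[OF tendsto_ident_at] this]]
  have "((\<lambda>x. 1 + x ^ 2 * ((\<Sum>\<omega>\<in>F. wterm x \<omega>) + h x)) \<longlongrightarrow> 1 + 0 ^ 2 * ((\<Sum>\<omega>\<in>F. wterm 0 \<omega>) + h 0)) (at 0)" .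
  moreover have "eventually (\<lambda>x. x \<in> ball (0::complex) 1 - {0}) (at 0)"
    by (intro eventually_at_in_open) auto
  hence "eventually (\<lambda>x. 1 + x ^ 2 * ((\<Sum>\<omega>\<in>F. wterm x \<omega>) + h x) = x ^ 2 * wp x) (at 0)"
  proof eventually_elim
    case (elim x)
    hence "wp x = 1 / x ^ 2 + (\<Sum>\<omega>\<in>F. wterm x \<omega>) + h x" using h(2)[of x] unfolding sumF by simp
    moreover have "1 + x ^ 2 * (S + H) = x ^ 2 * (1 / x ^ 2 + S + H)" for S H
      using elim by (simp add: distrib_left)
    ultimately show ?case by metis
  qed
  ultimately show ?thesis by (auto elim: Lim_transform_eventually)
qed

text \<open>Reindexing shows that the difference is a sum not depending on \<open>z\<close>, and the reflection
  \<open>\<omega> \<mapsto> - \<omega> - \<kappa>\<close> changes the sign of that sum.\<close>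

lemma wp_add_lattice:
  assumes "\<kappa> \<in> L"
  shows "wp (z + \<kappa>) = wp z"
proof -
  define d where "d = (\<lambda>\<omega>. 1 / \<omega> ^ 2 - 1 / (\<omega> + \<kappa>) ^ 2)"
  have re: "infsum (wterm (z + \<kappa>)) L = infsum (\<lambda>\<omega>. wterm (z + \<kappa>) (\<omega> + \<kappa>)) L"
    by (rule infsum_reindex_bij_witness[of _ "\<lambda>\<omega>. \<omega> + \<kappa>" "\<lambda>\<omega>. \<omega> - \<kappa>"]) (use assms L_add L_diff in auto)
  have sm: "(\<lambda>\<omega>. wterm (z + \<kappa>) (\<omega> + \<kappa>)) summable_on L" for z
  proof -
    have "wterm (z + \<kappa>) summable_on L \<longleftrightarrow> (\<lambda>\<omega>. wterm (z + \<kappa>) (\<omega> + \<kappa>)) summable_on L"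
      by (rule summable_on_reindex_bij_witness[of _ "\<lambda>\<omega>. \<omega> + \<kappa>" "\<lambda>\<omega>. \<omega> - \<kappa>"]) (use assms L_add L_diff in auto)
    thus ?thesis using wterm_summable by simp
  qed
  have "wp (z + \<kappa>) - wp z = infsum (\<lambda>\<omega>. wterm (z + \<kappa>) (\<omega> + \<kappa>) - wterm z \<omega>) L"
    using infsum_add[OF sm[of z] summable_on_uminus[THEN iffD2, OF wterm_summable[of z]]]
    by (simp add: wp_eq re infsum_uminus)
  also have "(\<lambda>\<omega>. wterm (z + \<kappa>) (\<omega> + \<kappa>) - wterm z \<omega>) = d"
    by (simp add: wterm_def d_def fun_eq_iff)
  finally have eq: "wp (z + \<kappa>) - wp z = infsum d L" .
  have "infsum d L = infsum (\<lambda>\<omega>. d (- \<omega> - \<kappa>)) L"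
    by (rule infsum_reindex_bij_witness[of _ "\<lambda>\<omega>. - \<omega> - \<kappa>" "\<lambda>\<omega>. - \<omega> - \<kappa>"])
       (use assms L_add L_diff L_uminus in auto)
  also have "(\<lambda>\<omega>. d (- \<omega> - \<kappa>)) = (\<lambda>\<omega>. - d \<omega>)"
    by (simp add: d_def fun_eq_iff power2_eq_square algebra_simps)
  also have "infsum (\<lambda>\<omega>. - d \<omega>) L = - infsum d L" by (rule infsum_uminus)
  finally have "infsum d L = 0" by simp
  thus ?thesis using eq by simp
qed

lemma wp_minus: "wp (- z) = wp z"
proof -
  have "infsum (wterm (- z)) L = infsum (wterm z) L"
    by (rule infsum_reindex_bij_witness[of _ uminus uminus])
       (auto simp: wterm_def power2_eq_square algebra_simps)
  thus ?thesis by (simp add: wp_eq)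
qed

text \<open>Multiplication by \<open>\<i>\<close> permutes the lattice and changes the sign of every
  square in the sum.\<close>

lemma wp_mult_i: "wp (\<i> * z) = - wp z"
proof -
  have eq: "wterm (\<i> * z) (\<i> * \<omega>) = - wterm z \<omega>" for \<omega>
  proof -
    have "(\<i> * z - \<i> * \<omega>) ^ 2 = - ((z - \<omega>) ^ 2)" "(\<i> * \<omega>) ^ 2 = - (\<omega> ^ 2)"
      by (simp_all add: power_mult_distrib flip: right_diff_distrib)
    thus ?thesis by (simp add: wterm_def)
  qed
  have "infsum (\<lambda>\<omega>. - wterm z \<omega>) L = infsum (wterm (\<i> * z)) L"
    by (rule infsum_reindex_bij_witness[of _ "\<lambda>\<omega>. - (\<i> * \<omega>)" "\<lambda>\<omega>. \<i> * \<omega>"])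
       (auto simp: eq simp flip: mult.assoc)
  thus ?thesis by (simp add: wp_eq infsum_uminus)
qed

lemma wp_cnj: "wp (cnj z) = cnj (wp z)"
proof -
  have "infsum (\<lambda>\<omega>. cnj (wterm z \<omega>)) L = infsum (wterm (cnj z)) L"
    by (rule infsum_reindex_bij_witness[of _ cnj cnj]) (auto simp: wterm_def)
  thus ?thesis by (simp add: wp_eq)
qed

section \<open>Discreteness of the lattice and of the level sets of \<open>wp\<close>\<close>

lemma not_islimpt_L: "\<not> x islimpt L"
proof
  assume "x islimpt L"
  hence "x islimpt (L \<inter> ball x 1)"
    by (rule islimpt_Int_eventually) (intro eventually_at_in_open', auto)
  moreover have "L \<inter> ball x 1 \<subseteq> L \<inter> cball 0 (norm x + 1)"
  proof
    fix y assume "y \<in> L \<inter> ball x 1"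
    moreover have "norm y \<le> norm x + dist x y"
      using norm_triangle_sub[of y x] by (simp add: dist_norm norm_minus_commute)
    ultimately show "y \<in> L \<inter> cball 0 (norm x + 1)" by auto
  qed
  hence "finite (L \<inter> ball x 1)" using finite_L_cball finite_subset by blast
  ultimately show False using islimpt_finite by blast
qed

lemma closed_L: "closed L"
  using not_islimpt_L by (simp add: closed_limpt)

lemma eventually_notin_L: "eventually (\<lambda>z. z \<notin> L) (at x)"
  using not_islimpt_L[of x] by (simp add: islimpt_conv_frequently_at frequently_def)

lemma countable_L: "countable L"
proof -
  have "L = range (\<lambda>(m, n). Complex (of_int m * \<alpha>) (of_int n * \<alpha>))" by (force simp: L_iff)
  thus ?thesis by (metis countable_image countableI_type)
qed

lemma wp_holomorphic: "wp holomorphic_on - L"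
  using wp_analytic analytic_imp_holomorphic analytic_on_analytic_at by blast

lemma wp_at_infinity_at_zero: "filterlim wp at_infinity (at 0)"
proof -
  have "filterlim (\<lambda>z::complex. inverse (z ^ 2)) at_infinity (at 0)"
    by (rule filterlim_compose[OF filterlim_inverse_at_infinity])
       (auto simp: filterlim_at eventually_at_filter intro!: tendsto_eq_intros)
  hence "filterlim (\<lambda>z. z ^ 2 * wp z * inverse (z ^ 2)) at_infinity (at 0)"
    by (intro tendsto_mult_filterlim_at_infinity[OF wp_double_pole]) auto
  moreover have "eventually (\<lambda>z. z ^ 2 * wp z * inverse (z ^ 2) = wp z) (at 0)"
    using eventually_neq_at_within[of 0] by eventually_elim simp
  ultimately show ?thesis by (simp cong: filterlim_cong)
qed

lemma wp_at_infinity: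
  assumes "\<kappa> \<in> L"
  shows "filterlim wp at_infinity (at \<kappa>)"
proof -
  have "filterlim (\<lambda>z. wp (z + \<kappa>)) at_infinity (at 0)"
    using wp_at_infinity_at_zero by (simp add: wp_add_lattice[OF assms])
  thus ?thesis by (subst at_to_0) (simp add: filterlim_filtermap)
qed

text \<open>The complement of the countable closed lattice is connected, so a value accumulating at
  a point of it would, by the identity theorem, be taken throughout, against the pole at 0. This
  later pulls statements with finitely many exceptions back along \<open>wp\<close>.\<close>

lemma wp_eventually_neq: "eventually (\<lambda>z. wp z \<noteq> v) (at x)"
proof (cases "x \<in> L")
  case True
  from wp_at_infinity[OF this] have "eventually (\<lambda>z. norm (wp z) \<ge> norm v + 1) (at x)"
    unfolding filterlim_at_infinity[OF order.refl] using add_nonneg_pos[OF norm_ge_zero zero_less_one] by blast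
  thus ?thesis by eventually_elim auto
next
  case False
  show ?thesis
  proof (rule ccontr)
    assume "\<not> ?thesis"
    hence "frequently (\<lambda>z. wp z = v) (at x)" by (simp add: frequently_def)
    moreover have "eventually (\<lambda>z. wp z = v \<longrightarrow> z \<in> {z \<in> - L. wp z = v}) (at x)"
      using eventually_notin_L[of x] by eventually_elim auto
    ultimately have "frequently (\<lambda>z. z \<in> {z \<in> - L. wp z = v}) (at x)" by (rule frequently_rev_mp)
    hence lim: "x islimpt {z \<in> - L. wp z = v}" by (simp add: islimpt_conv_frequently_at)
    have con: "connected (- L)" 
      using countable_L by (intro path_connected_imp_connected path_connected_complement_countable) auto
    have "wp z - v = 0" if "z \<in> - L" for z
    proof (rule analytic_continuation[of "\<lambda>z. wp z - v" "- L" "{z \<in> - L. wp z = v}" x z])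
      show "(\<lambda>z. wp z - v) holomorphic_on - L" by (intro holomorphic_intros wp_holomorphic)
    qed (use closed_L con lim False that in auto)
    hence all: "wp z = v" if "z \<in> - L" for z using that by simp
    have "eventually (\<lambda>z. wp z = v) (at 0)"
      using eventually_notin_L[of 0] by eventually_elim (simp add: all)
    hence "(wp \<longlongrightarrow> v) (at 0)" by (rule tendsto_eventually)
    thus False using wp_at_infinity_at_zero not_tendsto_and_filterlim_at_infinity[OF at_neq_bot] by blast
  qed
qed

end

section \<open>Even elliptic functions\<close>

lemma filterlim_at_translate:
  fixes k :: "complex \<Rightarrow> 'b"
  shows "filterlim (\<lambda>w. k (w + d)) F (at z) \<longleftrightarrow> filterlim k F (at (z + d))"
proof -
  have "filtermap (\<lambda>x. x - d) (at (z + d)) = at z"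
    using filtermap_at_shift[of d "z + d"] by simp
  hence "filterlim (\<lambda>w. k (w + d)) F (at z) \<longleftrightarrow> filterlim (\<lambda>w. k (w + d)) F (filtermap (\<lambda>x. x - d) (at (z + d)))"
    by simp
  also have "\<dots> \<longleftrightarrow> filterlim k F (at (z + d))" by (simp add: filterlim_filtermap)
  finally show ?thesis .
qed

lemma meromorphic_on_poly:
  "f meromorphic_on A \<Longrightarrow> (\<lambda>z. poly p (f z)) meromorphic_on A"
  unfolding poly_altdef by (intro meromorphic_intros)

lemma meromorphic_limit:
  assumes "f meromorphic_on {s}" "\<not> is_pole f s"
  shows "\<exists>l. (f \<longlongrightarrow> l) (at s)"
  using assms by (auto simp: meromorphic_at_iff not_essential_def)

text \<open>The exponent is 0 at a regular point and the order of the pole otherwise. A bound in the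
  form of a limit is all that the cancellation arguments below use.\<close>

lemma meromorphic_power_limit:
  assumes "f meromorphic_on {s}"
  shows "\<exists>N l. ((\<lambda>z. (z - s) ^ N * f z) \<longlongrightarrow> l) (at s)"
proof (cases "is_pole f s")
  case False
  then obtain l where "(f \<longlongrightarrow> l) (at s)" using meromorphic_limit[OF assms] by blast
  hence "((\<lambda>z. (z - s) ^ 0 * f z) \<longlongrightarrow> l) (at s)" by simp
  thus ?thesis by blast
next
  case True
  from assms have "isolated_singularity_at f s" by (simp add: meromorphic_at_iff)
  then obtain S where S: "open S" "s \<in> S" "f holomorphic_on S - {s}"
    using analytic_imp_holomorphic isolated_singularity_at_iff_analytic_nhd by auto
  define n where "n = nat (- zorder f s)"
  define g where "g = zor_poly f s"
  obtain r where r: "r > 0" "g holomorphic_on cball s r" "\<forall>w\<in>cball s r - {s}. f w = g w / (w - s) ^ n"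
    using zorder_exist_pole[OF S(3,1,2) True] unfolding n_def g_def by blast
  have "g analytic_on {s}"
    using r(1,2) by (meson analytic_at_ball ball_subset_cball holomorphic_on_subset)
  hence "(g \<longlongrightarrow> g s) (at s)" using analytic_at_imp_isCont isCont_def by blast
  moreover have "eventually (\<lambda>w. w \<in> ball s r - {s}) (at s)"
    using r(1) by (intro eventually_at_in_open) auto
  hence "eventually (\<lambda>w. g w = (w - s) ^ n * f w) (at s)"
  proof eventually_elim
    case (elim w)
    hence "f w = g w / (w - s) ^ n" using r(3) by auto
    thus ?case using elim by simp
  qed
  ultimately have "((\<lambda>z. (z - s) ^ n * f z) \<longlongrightarrow> g s) (at s)" by (rule Lim_transform_eventually)
  thus ?thesis by blast
qed

context square_weierstrass
begin

lemma lattice_reduce: "\<exists>\<kappa>\<in>L. z - \<kappa> \<in> cbox 0 (Complex \<alpha> \<alpha>)"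
proof -
  define m n where "m = \<lfloor>Re z / \<alpha>\<rfloor>" and "n = \<lfloor>Im z / \<alpha>\<rfloor>"
  have "0 \<le> x - of_int \<lfloor>x / \<alpha>\<rfloor> * \<alpha> \<and> x - of_int \<lfloor>x / \<alpha>\<rfloor> * \<alpha> \<le> \<alpha>" for x :: real
  proof -
    have "of_int \<lfloor>x / \<alpha>\<rfloor> * \<alpha> \<le> x / \<alpha> * \<alpha>" "x / \<alpha> * \<alpha> \<le> (of_int \<lfloor>x / \<alpha>\<rfloor> + 1) * \<alpha>"
      using alpha_pos by (intro mult_right_mono; linarith)+
    thus ?thesis using alpha_pos by (simp add: distrib_right)
  qed
  hence "z - Complex (of_int m * \<alpha>) (of_int n * \<alpha>) \<in> cbox 0 (Complex \<alpha> \<alpha>)"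
    by (simp add: in_cbox_complex_iff m_def n_def)
  thus ?thesis using L_I by blast
qed

lemma wp_meromorphic: "wp meromorphic_on UNIV"
  unfolding meromorphic_on_meromorphic_at[of wp UNIV]
proof
  fix z
  show "wp meromorphic_on {z}"
  proof (cases "z \<in> L")
    case False
    thus ?thesis using wp_analytic analytic_on_imp_meromorphic_on by blast
  next
    case True
    have "is_pole wp z" using wp_at_infinity[OF True] by (simp add: is_pole_def)
    moreover obtain r where r: "r > 0" "\<forall>y\<in>ball z r - {z}. y \<notin> L"
      using eventually_notin_L[of z] by (auto simp: eventually_at dist_commute)
    hence "wp analytic_on ball z r - {z}"
      using wp_analytic analytic_on_analytic_at by blast
    hence "isolated_singularity_at wp z" using r(1) by (auto simp: isolated_singularity_at_def)
    ultimately show ?thesis by (auto simp: meromorphic_at_iff)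
  qed
qed

text \<open>With singularities removed the function is entire, and all its values are taken on one
  compact period square, so Liouville applies. The conclusion is about punctured neighbourhoods
  because \<open>k\<close> may have stray values at isolated points.\<close>

lemma elliptic_without_poles:
  assumes mero: "k meromorphic_on UNIV"
    and per: "\<And>z \<kappa>. \<kappa> \<in> L \<Longrightarrow> k (z + \<kappa>) = k z"
    and lim: "\<And>z. \<exists>l. (k \<longlongrightarrow> l) (at z)"
  shows "\<exists>c. \<forall>z. eventually (\<lambda>w. k w = c) (at z)"
proof -
  define g where "g = remove_sings k"
  have iso: "isolated_singularity_at k z" for z
    using meromorphic_on_subset[OF mero, of "{z}"] by (simp add: meromorphic_at_iff)
  have klim: "(k \<longlongrightarrow> g z) (at z)" for z
    using lim[of z] remove_sings_eqI unfolding g_def by metis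
  have "g analytic_on {z}" for z
    unfolding g_def by (rule remove_sings_analytic_at[OF iso klim])
  hence ana: "g analytic_on UNIV" using analytic_on_analytic_at by blast
  hence hol: "g holomorphic_on UNIV" by (rule analytic_imp_holomorphic)
  have gper: "g (z + \<kappa>) = g z" if "\<kappa> \<in> L" for z \<kappa>
  proof -
    have "((\<lambda>w. k (w + \<kappa>)) \<longlongrightarrow> g (z + \<kappa>)) (at z)"
      unfolding filterlim_at_translate by (rule klim)
    hence "(k \<longlongrightarrow> g (z + \<kappa>)) (at z)" by (simp add: per[OF that])
    thus ?thesis using klim[of z] tendsto_unique[OF at_neq_bot] by blast
  qed
  have "continuous_on (cbox 0 (Complex \<alpha> \<alpha>)) g"
    using hol holomorphic_on_imp_continuous_on continuous_on_subset by blast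
  hence bdd: "bounded (g ` cbox 0 (Complex \<alpha> \<alpha>))"
    by (intro compact_imp_bounded compact_continuous_image) auto
  have "range g \<subseteq> g ` cbox 0 (Complex \<alpha> \<alpha>)"
  proof
    fix y assume "y \<in> range g"
    then obtain z where y: "y = g z" by blast
    obtain \<kappa> where k: "\<kappa> \<in> L" "z - \<kappa> \<in> cbox 0 (Complex \<alpha> \<alpha>)" using lattice_reduce by blast
    have "y = g (z - \<kappa>)" using gper[OF k(1), of "z - \<kappa>"] y by simp
    thus "y \<in> g ` cbox 0 (Complex \<alpha> \<alpha>)" using k by blast
  qed
  hence "bounded (range g)" using bdd bounded_subset by blast
  then obtain c where c: "\<And>z. g z = c" using Liouville_theorem[OF hol] by (auto simp: constant_on_def)
  have "eventually (\<lambda>w. k w = c) (at z)" for z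
    using eventually_remove_sings_eq_at[OF iso[of z]] by eventually_elim (use c in \<open>simp add: g_def\<close>)
  thus ?thesis by blast
qed

lemma filterlim_uminus_at_0: "filterlim (\<lambda>z::complex. - z) (at 0) (at 0)"
  by (auto simp: filterlim_at eventually_at_filter intro!: tendsto_eq_intros)

text \<open>Subtracting a multiple of a power of \<open>wp\<close> removes the leading pole term; since the function is
  even, this lowers the order of the pole by two.\<close>

lemma elliptic_even_polynomial:
  assumes "k meromorphic_on UNIV"
    and "\<And>z \<kappa>. \<kappa> \<in> L \<Longrightarrow> k (z + \<kappa>) = k z"
    and "\<And>z. k (- z) = k z"
    and "\<And>z. z \<notin> L \<Longrightarrow> \<exists>l. (k \<longlongrightarrow> l) (at z)"
    and "((\<lambda>z. z ^ (2 * n) * k z) \<longlongrightarrow> l) (at 0)"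
  shows "\<exists>A. \<forall>z. eventually (\<lambda>w. k w = poly A (wp w)) (at z)"
  using assms
proof (induction n arbitrary: k l)
  case 0
  \<comment> \<open>With exponent 0 the hypothesis at the origin is a finite limit, and periodicity
    carries it to every lattice point.\<close>
  have "\<exists>l. (k \<longlongrightarrow> l) (at z)" for z
  proof (cases "z \<in> L")
    case True
    have "(k \<longlongrightarrow> l) (at 0)" using 0(5) by simp
    hence "((\<lambda>w. k (w + z)) \<longlongrightarrow> l) (at 0)" by (simp add: 0(2)[OF True])
    thus ?thesis unfolding filterlim_at_translate by auto
  qed (use 0 in blast)
  from elliptic_without_poles[OF 0(1,2) this]
  obtain c where "\<And>z. eventually (\<lambda>w. k w = c) (at z)" by blast
  hence "\<forall>z. eventually (\<lambda>w. k w = poly [:c:] (wp w)) (at z)" by simp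
  thus ?case by blast
next
  case (Suc n)
  define k' where "k' = (\<lambda>z. k z - l * wp z ^ Suc n)"
  define v where "v = (\<lambda>z. z ^ (2 * Suc n) * k' z)"
  define g where "g = remove_sings v"
  have mero': "k' meromorphic_on UNIV" unfolding k'_def
    by (intro meromorphic_intros Suc.prems(1) wp_meromorphic)
  have vmero: "v meromorphic_on UNIV" unfolding v_def by (intro meromorphic_intros mero')
  have even': "k' (- z) = k' z" for z by (simp add: k'_def Suc.prems(3) wp_minus)
  have "((\<lambda>z. z ^ (2 * Suc n) * k z - l * (z ^ 2 * wp z) ^ Suc n) \<longlongrightarrow> l - l * 1 ^ Suc n) (at 0)"
    by (intro tendsto_diff tendsto_mult tendsto_power tendsto_const Suc.prems(5) wp_double_pole)
  moreover have "(\<lambda>z. z ^ (2 * Suc n) * k z - l * (z ^ 2 * wp z) ^ Suc n) = v"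
    unfolding v_def k'_def power_mult_distrib power_mult[symmetric] by (simp add: fun_eq_iff algebra_simps)
  ultimately have vlim: "(v \<longlongrightarrow> 0) (at 0)" by simp
  have iso: "isolated_singularity_at v 0"
    using meromorphic_on_subset[OF vmero, of "{0}"] by (simp add: meromorphic_at_iff)
  have g0: "g 0 = 0" unfolding g_def by (rule remove_sings_eqI[OF vlim])
  have gana: "g analytic_on {0}" unfolding g_def by (rule remove_sings_analytic_at[OF iso vlim])
  have ev: "eventually (\<lambda>w. g w = v w) (at 0)"
    unfolding g_def by (rule eventually_remove_sings_eq_at[OF iso])
  have "v (- z) = v z" for z by (simp add: v_def even')
  with ev eventually_compose_filterlim[OF ev filterlim_uminus_at_0]
  have "eventually (\<lambda>z. g (- z) = g z) (at 0)" by (auto elim: eventually_elim2)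
  \<comment> \<open>\<open>g\<close> is even and vanishes at 0, hence vanishes doubly; dividing by
    \<open>z ^ 2\<close> lowers the exponent from \<open>2 * Suc n\<close> to
    \<open>2 * n\<close>.\<close>
  then obtain l' where "((\<lambda>z. g z / z ^ 2) \<longlongrightarrow> l') (at 0)"
    using even_analytic_zero_limit[OF gana g0] by blast
  moreover have "eventually (\<lambda>z. g z / z ^ 2 = z ^ (2 * n) * k' z) (at 0)"
    using ev eventually_neq_at_within[of 0]
    by eventually_elim (simp add: v_def power_add power2_eq_square)
  ultimately have lim': "((\<lambda>z. z ^ (2 * n) * k' z) \<longlongrightarrow> l') (at 0)" by (rule Lim_transform_eventually)
  have "\<exists>A. \<forall>z. eventually (\<lambda>w. k' w = poly A (wp w)) (at z)"
  proof (rule Suc.IH[OF mero' _ even' _ lim'])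
    show "k' (z + \<kappa>) = k' z" if "\<kappa> \<in> L" for z \<kappa>
      using that by (simp add: k'_def Suc.prems(2) wp_add_lattice)
    show "\<exists>l. (k' \<longlongrightarrow> l) (at z)" if z: "z \<notin> L" for z
    proof -
      obtain l1 where "(k \<longlongrightarrow> l1) (at z)" using Suc.prems(4)[OF z] by blast
      moreover have "(wp \<longlongrightarrow> wp z) (at z)"
        using analytic_at_imp_isCont[OF wp_analytic[OF z]] by (simp add: isCont_def)
      ultimately have "(k' \<longlongrightarrow> l1 - l * wp z ^ Suc n) (at z)"
        unfolding k'_def by (intro tendsto_diff tendsto_mult tendsto_power tendsto_const)
      thus ?thesis by blast
    qed
  qed
  then obtain A where A: "\<And>z. eventually (\<lambda>w. k' w = poly A (wp w)) (at z)" by blast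
  have "eventually (\<lambda>w. k w = poly (A + monom l (Suc n)) (wp w)) (at z)" for z
    using A[of z] by eventually_elim (simp add: k'_def poly_monom algebra_simps)
  thus ?case by blast
qed

text \<open>By compactness a period square has finitely many poles off the lattice, and factors
  \<open>wp z - wp s\<close> raised to suitable powers cancel them. Poles at lattice points may
  remain, since a polynomial in \<open>wp\<close> accounts for them.\<close>

lemma elliptic_even_rational:
  assumes mero: "h meromorphic_on UNIV"
    and per: "\<And>z \<kappa>. \<kappa> \<in> L \<Longrightarrow> h (z + \<kappa>) = h z"
    and even: "\<And>z. h (- z) = h z"
  shows "\<exists>A B. B \<noteq> 0 \<and> (\<forall>z. eventually (\<lambda>w. h w * poly B (wp w) = poly A (wp w)) (at z))"
proof -
  have mero_at: "h meromorphic_on {z}" for z using mero meromorphic_on_subset by blast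
  define S where "S = {z \<in> cbox 0 (Complex \<alpha> \<alpha>). is_pole h z} - L"
  have "{z. is_pole h z} sparse_in UNIV"
    using meromorphic_on_imp_not_pole_cosparse[OF mero] by (simp add: eventually_cosparse)
  hence "{z. is_pole h z} sparse_in cbox 0 (Complex \<alpha> \<alpha>)" by (rule sparse_in_subset) auto
  hence "finite (cbox 0 (Complex \<alpha> \<alpha>) \<inter> {z. is_pole h z})"
    by (intro sparse_in_compact_finite) auto
  hence fin: "finite S" unfolding S_def by (rule rev_finite_subset) auto
  obtain N l where Nl: "\<And>s. ((\<lambda>z. (z - s) ^ N s * h z) \<longlongrightarrow> l s) (at s)"
    using meromorphic_power_limit[OF mero_at] by metis
  define B where "B = (\<Prod>s\<in>S. [:- wp s, 1:] ^ N s)"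
  have B0: "B \<noteq> 0" unfolding B_def using fin by (subst prod_zero_iff) auto
  have B: "poly B (wp z) = (\<Prod>s\<in>S. (wp z - wp s) ^ N s)" for z
    by (simp add: B_def poly_prod)
  define k where "k = (\<lambda>z. h z * poly B (wp z))"
  have kmero: "k meromorphic_on UNIV" unfolding k_def
    by (intro meromorphic_intros mero meromorphic_on_poly wp_meromorphic)
  have kper: "k (z + \<kappa>) = k z" if "\<kappa> \<in> L" for z \<kappa>
    using that by (simp add: k_def per wp_add_lattice)
  have keven: "k (- z) = k z" for z by (simp add: k_def even wp_minus)
  have klim: "\<exists>l. (k \<longlongrightarrow> l) (at z)" if z: "z \<notin> L" for z
  proof -
    obtain \<kappa> where kap: "\<kappa> \<in> L" "z - \<kappa> \<in> cbox 0 (Complex \<alpha> \<alpha>)" using lattice_reduce by blast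
    define q where "q = z - \<kappa>"
    have q: "q \<notin> L" "q \<in> cbox 0 (Complex \<alpha> \<alpha>)" 
      using z kap L_add[of q \<kappa>] by (auto simp: q_def)
    have wlim: "(wp \<longlongrightarrow> wp q) (at q)"
      using analytic_at_imp_isCont[OF wp_analytic[OF q(1)]] by (simp add: isCont_def)
    have "\<exists>l. (k \<longlongrightarrow> l) (at q)"
    proof (cases "q \<in> S")
      case False
      hence "\<not> is_pole h q" using q by (auto simp: S_def)
      then obtain l1 where "(h \<longlongrightarrow> l1) (at q)" using meromorphic_limit[OF mero_at] by blast
      hence "(k \<longlongrightarrow> l1 * poly B (wp q)) (at q)"
        unfolding k_def using wlim by (intro tendsto_mult tendsto_poly)
      thus ?thesis by blast
    next
      case True
      \<comment> \<open>The derivative may vanish, as at a half period; then the factor cancels more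
        than the pole, and the limit still exists.\<close>
      have "(wp has_field_derivative deriv wp q) (at q)"
        using wp_analytic[OF q(1)] analytic_on_imp_differentiable_at DERIV_deriv_iff_field_differentiable by blast
      hence "((\<lambda>w. (wp w - wp q) / (w - q)) \<longlongrightarrow> deriv wp q) (at q)"
        by (simp add: has_field_derivative_iff)
      hence "((\<lambda>w. ((w - q) ^ N q * h w) * ((wp w - wp q) / (w - q)) ^ N q * (\<Prod>s\<in>S - {q}. (wp w - wp s) ^ N s)) \<longlongrightarrow>
          l q * deriv wp q ^ N q * (\<Prod>s\<in>S - {q}. (wp q - wp s) ^ N s)) (at q)"
        by (intro tendsto_mult tendsto_power tendsto_prod tendsto_diff tendsto_const wlim Nl)
      moreover have "eventually (\<lambda>w. ((w - q) ^ N q * h w) * ((wp w - wp q) / (w - q)) ^ N q * (\<Prod>s\<in>S - {q}. (wp w - wp s) ^ N s) = k w) (at q)"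
        using eventually_neq_at_within[of q]
      proof eventually_elim
        case (elim w)
        have "poly B (wp w) = (wp w - wp q) ^ N q * (\<Prod>s\<in>S - {q}. (wp w - wp s) ^ N s)"
          unfolding B by (rule prod.remove[OF fin True])
        moreover have "(w - q) ^ N q * ((wp w - wp q) / (w - q)) ^ N q = (wp w - wp q) ^ N q"
          using elim by (simp flip: power_mult_distrib)
        moreover have "a * b * d * e = b * (a * d * e)" for a b d e :: complex
          by (simp only: mult_ac)
        ultimately show ?case unfolding k_def by metis
      qed
      ultimately show ?thesis by (blast intro: Lim_transform_eventually)
    qed
    then obtain l1 where "(k \<longlongrightarrow> l1) (at q)" by blast
    hence "((\<lambda>w. k (w + \<kappa>)) \<longlongrightarrow> l1) (at q)" by (simp add: kper[OF kap(1)])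
    thus ?thesis unfolding filterlim_at_translate by (auto simp: q_def)
  qed
  have "k meromorphic_on {0}" using kmero meromorphic_on_subset by blast
  then obtain M l0 where "((\<lambda>z. (z - 0) ^ M * k z) \<longlongrightarrow> l0) (at 0)"
    using meromorphic_power_limit by blast
  \<comment> \<open>The exponent is doubled because the reduction to polynomials is stated for even
    exponents.\<close>
  hence "((\<lambda>z. z ^ M * ((z - 0) ^ M * k z)) \<longlongrightarrow> 0 ^ M * l0) (at 0)"
    by (intro tendsto_mult tendsto_power tendsto_ident_at)
  hence "((\<lambda>z. z ^ (2 * M) * k z) \<longlongrightarrow> 0 ^ M * l0) (at 0)"
    by (simp add: mult_2 power_add mult.assoc)
  from elliptic_even_polynomial[OF kmero kper keven klim this]
  obtain A where "\<And>z. eventually (\<lambda>w. k w = poly A (wp w)) (at z)" by blast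
  thus ?thesis using B0 unfolding k_def by blast
qed

text \<open>The centre of the period square. It is also the translation part of the glide reflexion,
  since \<open>glide_L \<alpha> z = cnj (z + w3)\<close>.\<close>

definition w3 :: complex where "w3 = of_real \<alpha> * (1 + \<i>) / 2"

lemma w3_notin_L: "w3 \<notin> L"
  unfolding w3_def by (rule half_notin_L) simp

lemma two_w3_in_L: "w3 + w3 \<in> L"
proof -
  have "w3 + w3 = of_real \<alpha> + of_real \<alpha> * \<i>" by (simp add: w3_def field_simps)
  thus ?thesis using L_add alpha_in_L by simp
qed

text \<open>The rotation moves \<open>w3\<close> by a lattice vector, so the value there equals its
  own negative.\<close>

lemma wp_w3: "wp w3 = 0"
proof -
  have "\<i> * w3 = w3 + - of_real \<alpha>" by (simp add: w3_def complex_eq_iff)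
  hence "wp (\<i> * w3) = wp w3" using wp_add_lattice[OF L_uminus[OF alpha_in_L(1)]] by simp
  thus ?thesis by (simp add: wp_mult_i)
qed

lemma wp_half_i: "wp (of_real \<alpha> * \<i> / 2) = - wp (of_real \<alpha> / 2)"
  using wp_mult_i[of "of_real \<alpha> / 2"] by (simp add: mult.commute)

lemma wp_half_real: "cnj (wp (of_real \<alpha> / 2)) = wp (of_real \<alpha> / 2)"
  by (simp flip: wp_cnj)

lemma wp_w3_minus: "wp (w3 - z) = wp (z + w3)"
proof -
  have "wp (w3 - z) = wp (z - w3)" using wp_minus[of "w3 - z"] by simp
  also have "\<dots> = wp (z - w3 + (w3 + w3))" by (rule wp_add_lattice[OF two_w3_in_L, symmetric])
  finally show ?thesis by (simp add: add.commute)
qed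

lemma notin_L_isCont: "z \<notin> L \<Longrightarrow> isCont wp z"
  using analytic_at_imp_isCont wp_analytic by blast

text \<open>The product below has no poles: \<open>wp\<close> is even about the half period \<open>w3\<close>, so its zero there is
  at least double and cancels the double pole of the other factor.\<close>

lemma
  shows wp_half_neq_0: "wp (of_real \<alpha> / 2) \<noteq> 0"
    and wp_times_wp_w3: "\<And>z. z \<notin> L \<Longrightarrow> z + w3 \<notin> L \<Longrightarrow> wp z * wp (z + w3) = - (wp (of_real \<alpha> / 2) ^ 2)"
proof -
  define k where "k = (\<lambda>z. wp z * wp (z + w3))"
  have wmero: "(\<lambda>z. wp (z + w3)) meromorphic_on UNIV"
    by (rule meromorphic_on_compose[OF wp_meromorphic, of "\<lambda>z. z + w3" UNIV, unfolded o_def])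
       (auto intro!: analytic_intros)
  have kmero: "k meromorphic_on UNIV" unfolding k_def
    by (intro meromorphic_intros wp_meromorphic wmero)
  have kper: "k (z + \<kappa>) = k z" if "\<kappa> \<in> L" for z \<kappa>
  proof -
    have "z + \<kappa> + w3 = (z + w3) + \<kappa>" by simp
    thus ?thesis using that unfolding k_def by (simp only: wp_add_lattice)
  qed
  have kper3: "k (z + w3) = k z" for z
    unfolding k_def using wp_add_lattice[OF two_w3_in_L, of z] by (simp add: add.assoc mult.commute)
  have kcont: "isCont k z" if "z \<notin> L" "z + w3 \<notin> L" for z
  proof -
    have "isCont (\<lambda>z. wp (z + w3)) z"
      by (rule isCont_o2[where g = wp and f = "\<lambda>z. z + w3"])
         (use notin_L_isCont[OF that(2)] in \<open>auto intro!: continuous_intros\<close>)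
    thus ?thesis unfolding k_def using notin_L_isCont[OF that(1)] by (intro continuous_intros)
  qed
  have k0: "\<exists>l. (k \<longlongrightarrow> l) (at 0)"
  proof -
    have "(\<lambda>z. wp (z + w3)) analytic_on {0}"
      by (rule analytic_on_compose[OF _ , of "\<lambda>z. z + w3" _ wp, unfolded o_def])
         (use w3_notin_L wp_analytic in \<open>auto intro!: analytic_intros\<close>)
    then obtain l where "((\<lambda>z. wp (z + w3) / z ^ 2) \<longlongrightarrow> l) (at 0)"
      using even_analytic_zero_limit[of "\<lambda>z. wp (z + w3)"] wp_w3 wp_w3_minus by auto
    hence "((\<lambda>z. (z ^ 2 * wp z) * (wp (z + w3) / z ^ 2)) \<longlongrightarrow> 1 * l) (at 0)"
      by (intro tendsto_mult wp_double_pole)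
    moreover have "eventually (\<lambda>z. (z ^ 2 * wp z) * (wp (z + w3) / z ^ 2) = k z) (at 0)"
      using eventually_neq_at_within[of 0] by eventually_elim (simp add: k_def)
    ultimately show ?thesis by (blast intro: Lim_transform_eventually)
  qed
  have "\<exists>l. (k \<longlongrightarrow> l) (at z)" for z
  proof -
    consider "z \<in> L" | "z + w3 \<in> L" | "z \<notin> L" "z + w3 \<notin> L" by blast
    thus ?thesis
    proof cases
      case 1
      have "((\<lambda>w. k (w + z)) \<longlongrightarrow> l) (at 0) \<longleftrightarrow> (k \<longlongrightarrow> l) (at 0)" for l by (simp add: kper[OF 1])
      thus ?thesis using k0 unfolding filterlim_at_translate by simp
    next
      case 2
      \<comment> \<open>Translations by \<open>w3\<close> and by the lattice point
        \<open>z + w3\<close> both preserve \<open>k\<close>; together they move the singularity at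
        \<open>z\<close> to the origin.\<close>
      have "k (w + z) = k w" for w
        using kper[OF 2, of w] kper3[of "w + z"] by (simp add: add.assoc)
      hence "((\<lambda>w. k (w + z)) \<longlongrightarrow> l) (at 0) \<longleftrightarrow> (k \<longlongrightarrow> l) (at 0)" for l by simp
      thus ?thesis using k0 unfolding filterlim_at_translate by simp
    next
      case 3
      thus ?thesis using kcont isCont_def by blast
    qed
  qed
  from elliptic_without_poles[OF kmero kper this]
  obtain c where c: "\<And>z. eventually (\<lambda>w. k w = c) (at z)" by blast
  have kc: "k z = c" if "z \<notin> L" "z + w3 \<notin> L" for z
  proof -
    have "(k \<longlongrightarrow> k z) (at z)" using kcont[OF that] by (simp add: isCont_def)
    thus ?thesis using tendsto_eventually[OF c[of z]] tendsto_unique[OF at_neq_bot] by blast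
  qed
  \<comment> \<open>Translation by \<open>w3\<close> takes one half period to the other modulo the
    lattice, and \<open>wp\<close> has opposite values at them; the constant is therefore minus a
    square.\<close>
  have eq: "of_real \<alpha> / 2 + w3 = of_real \<alpha> * \<i> / 2 + of_real \<alpha>"
    by (simp add: w3_def complex_eq_iff)
  have "of_real \<alpha> / 2 \<notin> L" using half_notin_L[of 1] by simp
  moreover have "of_real \<alpha> * \<i> / 2 \<notin> L" using half_notin_L[of \<i>] by simp
  hence "of_real \<alpha> / 2 + w3 \<notin> L" unfolding eq using L_add_iff[OF alpha_in_L(1)] by simp
  ultimately have "c = wp (of_real \<alpha> / 2) * wp (of_real \<alpha> / 2 + w3)"
    using kc unfolding k_def by metis
  also have "wp (of_real \<alpha> / 2 + w3) = - wp (of_real \<alpha> / 2)"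
    unfolding eq using wp_add_lattice[OF alpha_in_L(1)] wp_half_i by simp
  finally have ce: "c = - (wp (of_real \<alpha> / 2) ^ 2)" by (simp add: power2_eq_square)
  \<comment> \<open>Near the origin neither factor takes the value 0, so their product cannot vanish
    there.\<close>
  have "c \<noteq> 0"
  proof
    assume c0: "c = 0"
    have "filterlim (\<lambda>z. z + w3) (at (0 + w3)) (at 0)"
      unfolding filterlim_at_translate[of "\<lambda>z. z"] by (rule filterlim_ident)
    hence "eventually (\<lambda>z. wp (z + w3) \<noteq> 0) (at 0)"
      by (rule eventually_compose_filterlim[OF wp_eventually_neq])
    hence "eventually (\<lambda>z::complex. False) (at 0)"
      using c[of 0] wp_eventually_neq[of 0 0] by eventually_elim (simp add: k_def c0)
    thus False by simp
  qed
  thus "wp (of_real \<alpha> / 2) \<noteq> 0" using ce by auto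
  show "wp z * wp (z + w3) = - (wp (of_real \<alpha> / 2) ^ 2)" if "z \<notin> L" "z + w3 \<notin> L" for z
    using kc[OF that] ce unfolding k_def by simp
qed

lemma wp_tendsto: "sphere_tendsto wp (weierstrass_p L z) (at z)"
proof (cases "z \<in> L")
  case True
  thus ?thesis using wp_at_infinity by (simp add: weierstrass_p_def)
next
  case False
  thus ?thesis using notin_L_isCont by (simp add: weierstrass_p_def wp_def[symmetric] isCont_def)
qed

lemma weierstrass_p_add_lattice: "\<kappa> \<in> L \<Longrightarrow> weierstrass_p L (z + \<kappa>) = weierstrass_p L z"
  using wp_add_lattice[of \<kappa> z] by (simp add: weierstrass_p_def L_add_iff wp_def)

lemma weierstrass_p_mult_i: "weierstrass_p L (\<i> * z) = map_option uminus (weierstrass_p L z)"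
  using wp_mult_i[of z] by (simp add: weierstrass_p_def wp_def)

text \<open>The glide reflexion is translation by \<open>w3\<close> followed by conjugation, so the
  product formula gives \<open>- c ^ 2 / cnj (wp z)\<close>. The poles of the two factors are
  treated apart; they are where 0 and infinity are exchanged.\<close>

lemma weierstrass_p_glide:
  fixes c :: real
  assumes "c \<noteq> 0" "complex_of_real (c ^ 2) = wp (of_real \<alpha> / 2) ^ 2"
  shows "map_option (\<lambda>w. w / of_real c) (weierstrass_p L (glide_L \<alpha> z)) =
    sphere_antipode (map_option (\<lambda>w. w / of_real c) (weierstrass_p L z))"
proof -
  have g: "glide_L \<alpha> z = cnj (z + w3)" by (simp add: glide_L_def w3_def)
  consider "z \<in> L" | "z + w3 \<in> L" | "z \<notin> L" "z + w3 \<notin> L" by blast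
  thus ?thesis
  proof cases
    case 1
    have "wp (z + w3) = 0" using wp_add_lattice[OF 1, of w3] wp_w3 by (simp add: add.commute)
    moreover have "z + w3 \<notin> L" using L_add_iff[OF 1, of w3] w3_notin_L by (simp add: add.commute)
    ultimately show ?thesis using 1
      by (simp add: g weierstrass_p_def wp_def[symmetric] wp_cnj sphere_antipode_def del: complex_cnj_add)
  next
    case 2
    have "wp z = wp (- w3 + (z + w3))" by simp
    also have "\<dots> = wp (- w3)" by (rule wp_add_lattice[OF 2])
    finally have "wp z = 0" by (simp add: wp_minus wp_w3)
    moreover have "z \<notin> L" using L_add_iff[of z w3] 2 w3_notin_L by (auto simp: add.commute)
    ultimately show ?thesis using 2
      by (simp add: g weierstrass_p_def wp_def[symmetric] sphere_antipode_def del: complex_cnj_add)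
  next
    case 3
    have pr: "wp z * wp (z + w3) = - of_real (c ^ 2)"
      using wp_times_wp_w3[OF 3] assms(2) by simp
    hence nz: "wp z \<noteq> 0" using assms(1) by auto
    have "wp (z + w3) = - of_real (c ^ 2) / wp z" using pr nz by (simp add: field_simps)
    thus ?thesis using 3 nz assms(1)
      by (simp add: g weierstrass_p_def wp_def[symmetric] sphere_antipode_def wp_cnj power2_eq_square del: complex_cnj_add)
  qed
qed

end

section \<open>Uniqueness and evenness of rational functions\<close>

lemma poly_eqI_eval:
  fixes p q :: "complex poly"
  shows "(\<And>x. poly p x = poly q x) \<Longrightarrow> p = q"
  using poly_eq_poly_eq_iff[of p q] by blast

text \<open>In \<open>p = p(0) + x * r\<close> evenness of \<open>p\<close> makes \<open>r\<close>
  odd, hence \<open>r = x * s\<close> with \<open>s\<close> even and of smaller degree. Each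
  cancellation of \<open>x\<close> is made at nonzero points, an infinite set, and so holds for
  polynomials.\<close>

lemma even_poly_decomposition:
  fixes p :: "complex poly"
  assumes "pcompose p [:0, -1:] = p"
  obtains q where "p = pcompose q [:0, 0, 1:]"
proof -
  have "\<exists>q. p = pcompose q [:0, 0, 1:]" using assms
  proof (induction "degree p" arbitrary: p rule: less_induct)
    case less
    show ?case
    proof (cases "degree p = 0")
      case True
      then obtain c where "p = [:c:]" by (rule degree_eq_zeroE)
      hence "p = pcompose [:c:] [:0, 0, 1:]" by simp
      thus ?thesis by blast
    next
      case False
      have even: "poly p (- x) = poly p x" for x
        using arg_cong[OF less.prems, of "\<lambda>p. poly p x"] by (simp add: poly_pcompose)
      define r where "r = poly_shift 1 p"
      have p: "p = pCons (coeff p 0) r" unfolding r_def by (rule poly_eqI) (simp add: coeff_pCons coeff_poly_shift split: nat.splits)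
      have odd: "poly r (- x) = - poly r x" if "x \<noteq> 0" for x
      proof -
        have "- x * poly r (- x) = x * poly r x"
          using even[of x] by (subst (asm) (1 2) p) simp
        hence "x * poly r (- x) = x * (- poly r x)" by (metis minus_mult_left minus_mult_right minus_minus)
        thus ?thesis using that by (metis mult_left_cancel)
      qed
      have "pcompose r [:0, -1:] = - r"
      proof (rule poly_eq_of_infinite[of "- {0}"])
        show "infinite (- {0::complex})"
          using infinite_UNIV_char_0[where 'a = complex] by (metis finite.emptyI finite_compl finite_insert)
      qed (use odd in \<open>simp add: poly_pcompose\<close>)
      hence "poly (pcompose r [:0, -1:]) 0 = poly (- r) 0" by simp
      hence "poly r 0 = 0" by (simp add: poly_pcompose)
      define s where "s = poly_shift 1 r"
      have r: "r = pCons 0 s" unfolding s_def using \<open>poly r 0 = 0\<close>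
        by (intro poly_eqI) (simp add: coeff_pCons coeff_poly_shift poly_0_coeff_0 split: nat.splits)
      have evs: "poly s (- x) = poly s x" if "x \<noteq> 0" for x
        using odd[OF that] that unfolding r by simp
      have "pcompose s [:0, -1:] = s"
      proof (rule poly_eq_of_infinite[of "- {0}"])
        show "infinite (- {0::complex})"
          using infinite_UNIV_char_0[where 'a = complex] by (metis finite.emptyI finite_compl finite_insert)
      qed (use evs in \<open>simp add: poly_pcompose\<close>)
      moreover have "degree s < degree p"
      proof (cases "s = 0")
        case True thus ?thesis using False by simp
      next
        case s0: False
        have "p = pCons (coeff p 0) (pCons 0 s)" using p r by simp
        hence "degree p = Suc (Suc (degree s))" using s0 by (metis degree_pCons_eq pCons_eq_0_iff)
        thus ?thesis by simp
      qed
      ultimately obtain q where q: "s = pcompose q [:0, 0, 1:]" using less.hyps by blast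
      have "p = pcompose (pCons (coeff p 0) q) [:0, 0, 1:]"
        using p unfolding r q by (simp add: pcompose_pCons)
      thus ?thesis by blast
    qed
  qed
  thus thesis using that by blast
qed

lemma ratfun_eqI:
  assumes "infinite {w. ratfun_val R w = ratfun_val S w}"
  shows "R = S"
proof -
  define p q where "p = fst (quot_of_fract R)" and "q = snd (quot_of_fract R)"
  define p' q' where "p' = fst (quot_of_fract S)" and "q' = snd (quot_of_fract S)"
  have q: "q \<noteq> 0" "q' \<noteq> 0" by (simp_all add: q_def q'_def)
  have R: "R = to_fract p / to_fract q" unfolding p_def q_def by (rule ratfun_eq_quot)
  have S: "S = to_fract p' / to_fract q'" unfolding p'_def q'_def by (rule ratfun_eq_quot)
  have "infinite ({w. ratfun_val R w = ratfun_val S w} - {w. poly (q * q') w = 0})"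
    using assms q by (intro Diff_infinite_finite poly_roots_finite) auto
  hence "p * q' = p' * q"
    by (rule poly_eq_of_infinite) (auto simp: ratfun_val_def p_def q_def p'_def q'_def field_simps)
  hence "to_fract p * to_fract q' = to_fract p' * to_fract q" by (metis to_fract_mult)
  thus ?thesis unfolding R S using q by (simp add: frac_eq_eq)
qed

lemma ratfun_eval_Some:
  "poly (snd (quot_of_fract R)) w \<noteq> 0 \<Longrightarrow> ratfun_eval R (Some w) = Some (ratfun_val R w)"
  by (simp add: ratfun_eval_def ratfun_val_def case_prod_unfold Let_def)

lemma eventually_cofinite_scale:
  fixes c :: complex
  assumes "eventually P cofinite" "c \<noteq> 0"
  shows "eventually (\<lambda>w. P (c * w)) cofinite"
proof -
  have "inj (\<lambda>w. c * w)" using assms(2) by (auto simp: inj_on_def)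
  hence "finite ((\<lambda>w. c * w) -` {w. \<not> P w})"
    using assms(1) by (intro finite_vimageI) (auto simp: eventually_cofinite)
  thus ?thesis by (simp add: eventually_cofinite vimage_def)
qed

text \<open>The conjugate of a rational function at the antipode is again rational, so that
  antipodal symmetry needs to be checked at infinitely many points only.\<close>

lemma ratfun_antipodal_conjugate:
  "\<exists>S. eventually (\<lambda>w. ratfun_val S w = cnj (ratfun_val R (- 1 / cnj w))) cofinite"
proof -
  obtain p q where R: "R = to_fract p / to_fract q" "q \<noteq> 0" by (rule ratfun_cases)
  \<comment> \<open>\<open>conj p\<close> evaluates to \<open>cnj (p (- cnj w))\<close>; reversing
    its coefficients then replaces \<open>w\<close> by \<open>1 / w\<close> up to a power of
    \<open>w\<close>. The two powers are cross-multiplied in \<open>S\<close>.\<close>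
  define conj where "conj = (\<lambda>p. pcompose (map_poly cnj p) [:0, -1:])"
  have cp: "poly (conj p) x = cnj (poly p (- cnj x))" for p x
  proof -
    have "poly (map_poly cnj p) y = cnj (poly p (cnj y))" for y
      using poly_cnj[of p "cnj y"] by simp
    thus ?thesis by (simp add: conj_def poly_pcompose)
  qed
  have rf: "cnj (poly p (- 1 / cnj w)) = poly (reflect_poly (conj p)) w / w ^ degree (conj p)" if "w \<noteq> 0" for p w
    using that by (simp add: poly_reflect_poly_nz cp inverse_eq_divide)
  have cq: "conj q \<noteq> 0"
  proof
    assume "conj q = 0"
    hence "poly q x = 0" for x using cp[of q "- cnj x"] by simp
    thus False using R(2) poly_all_0_iff_0 by blast
  qed
  define S where "S = to_fract (reflect_poly (conj p) * monom 1 (degree (conj q))) / to_fract (reflect_poly (conj q) * monom 1 (degree (conj p)))"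
  have den: "reflect_poly (conj q) * monom 1 (degree (conj p)) \<noteq> 0" using cq by (simp add: monom_eq_0_iff)
  have nz: "eventually (\<lambda>w::complex. w \<noteq> 0) cofinite" by (simp add: eventually_cofinite)
  have "eventually (\<lambda>w. ratfun_val S w = cnj (ratfun_val R (- 1 / cnj w))) cofinite"
    using ratfun_val_Fract[OF den, of "reflect_poly (conj p) * monom 1 (degree (conj q))"]
      eventually_cofinite_antipode[OF ratfun_val_Fract[OF R(2), of p]] nz
    unfolding S_def[symmetric] R(1)[symmetric]
  proof eventually_elim
    case (elim w)
    have "cnj (ratfun_val R (- 1 / cnj w)) =
        (poly (reflect_poly (conj p)) w / w ^ degree (conj p)) / (poly (reflect_poly (conj q)) w / w ^ degree (conj q))"
      unfolding elim(2) complex_cnj_divide rf[OF elim(3)] ..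
    also have "\<dots> = ratfun_val S w" unfolding elim(1) by (simp add: poly_monom)
    finally show ?case ..
  qed
  thus ?thesis by blast
qed

lemma antipodal_symmetricI:
  assumes "infinite {w. ratfun_val R w = cnj (ratfun_val R (- 1 / cnj w))}"
  shows "antipodal_symmetric R"
proof -
  obtain S where S: "eventually (\<lambda>w. ratfun_val S w = cnj (ratfun_val R (- 1 / cnj w))) cofinite"
    using ratfun_antipodal_conjugate by blast
  have "infinite ({w. ratfun_val R w = cnj (ratfun_val R (- 1 / cnj w))} - {w. ratfun_val S w \<noteq> cnj (ratfun_val R (- 1 / cnj w))})"
    using assms S by (intro Diff_infinite_finite) (auto simp: eventually_cofinite)
  hence "infinite {w. ratfun_val R w = ratfun_val S w}" by (rule infinite_super[rotated]) auto
  hence "R = S" by (rule ratfun_eqI)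
  thus ?thesis using S by (simp add: antipodal_symmetric_def)
qed

lemma sphere_tendsto_square:
  "sphere_tendsto h x F \<Longrightarrow> sphere_tendsto (\<lambda>z. h z ^ 2) (map_option (\<lambda>w. w ^ 2) x) F"
  by (cases x) (auto intro!: tendsto_intros filterlim_power_at_infinity)

lemma sphere_tendsto_divide:
  assumes "sphere_tendsto h x F" "c \<noteq> 0"
  shows "sphere_tendsto (\<lambda>z. h z / c) (map_option (\<lambda>w. w / c) x) F"
proof (cases x)
  case None
  hence "filterlim (\<lambda>z. inverse c * h z) at_infinity F"
    using assms by (intro tendsto_mult_filterlim_at_infinity[OF tendsto_const]) auto
  thus ?thesis using None by (simp add: divide_inverse mult.commute)
qed (use assms in \<open>auto intro!: tendsto_intros\<close>)

text \<open>Extending the fraction by \<open>q (- w)\<close> makes the denominator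
  \<open>q w * q (- w)\<close> even, and evenness of the quotient makes the numerator
  \<open>p w * q (- w)\<close> even. Both are then polynomials in \<open>w ^ 2\<close>, with the
  scaling by \<open>c\<close> absorbed.\<close>

lemma even_ratfun_eval_square:
  assumes "infinite {w. ratfun_val Q (- w) = ratfun_val Q w}" "c \<noteq> 0"
  shows "\<exists>P. \<forall>x. ratfun_eval Q (map_option (\<lambda>w. w / c) x) = ratfun_eval P (map_option (\<lambda>w. w ^ 2) x)"
proof -
  obtain p q where Q: "Q = to_fract p / to_fract q" "q \<noteq> 0" by (rule ratfun_cases)
  define m where "m = (\<lambda>p::complex poly. pcompose p [:0, -1:])"
  define s where "s = (\<lambda>p::complex poly. pcompose p [:0, 1 / c:])"
  have pm: "poly (m p) w = poly p (- w)" for p w by (simp add: m_def poly_pcompose)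
  have ps: "poly (s p) w = poly p (w / c)" for p w by (simp add: s_def poly_pcompose)
  have mm: "m (m p) = p" for p by (rule poly_eqI_eval) (simp add: pm)
  have q0: "m q \<noteq> 0" using Q(2) mm[of q] by (metis m_def pcompose_0)
  define Q' where "Q' = to_fract (m p) / to_fract (m q)"
  have evQ: "eventually (\<lambda>w. ratfun_val Q w = poly p w / poly q w) cofinite"
    using ratfun_val_Fract[OF Q(2), of p] by (simp add: Q(1))
  have evm: "eventually (\<lambda>w. ratfun_val Q (- w) = poly p (- w) / poly q (- w)) cofinite"
    using eventually_cofinite_scale[OF evQ, of "-1"] by simp
  have evQ': "eventually (\<lambda>w. ratfun_val Q' w = poly p (- w) / poly q (- w)) cofinite"
    using ratfun_val_Fract[OF q0, of "m p"] by (simp add: Q'_def pm)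
  have "eventually (\<lambda>w. ratfun_val Q' w = ratfun_val Q (- w)) cofinite"
    using evm evQ' by eventually_elim simp
  hence "infinite ({w. ratfun_val Q (- w) = ratfun_val Q w} - {w. ratfun_val Q' w \<noteq> ratfun_val Q (- w)})"
    using assms(1) by (intro Diff_infinite_finite) (auto simp: eventually_cofinite)
  hence "infinite {w. ratfun_val Q' w = ratfun_val Q w}" by (rule infinite_super[rotated]) auto
  hence "Q' = Q" by (rule ratfun_eqI)
  hence "to_fract (m p) * to_fract q = to_fract p * to_fract (m q)"
    unfolding Q'_def Q(1) using Q(2) q0 by (simp add: frac_eq_eq)
  hence mpq: "m p * q = p * m q" by (metis to_fract_mult to_fract_eq_iff)
  obtain A where A: "s (p * m q) = pcompose A [:0, 0, 1:]"
  proof (rule even_poly_decomposition)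
    show "pcompose (s (p * m q)) [:0, -1:] = s (p * m q)"
    proof (rule poly_eqI_eval)
      fix x
      have "poly (pcompose (s (p * m q)) [:0, -1:]) x = poly (m p * q) (x / c)"
        by (simp add: poly_pcompose ps pm)
      thus "poly (pcompose (s (p * m q)) [:0, -1:]) x = poly (s (p * m q)) x"
        unfolding mpq ps .
    qed
  qed
  obtain B where B: "s (q * m q) = pcompose B [:0, 0, 1:]"
  proof (rule even_poly_decomposition)
    show "pcompose (s (q * m q)) [:0, -1:] = s (q * m q)"
      by (rule poly_eqI_eval) (simp add: poly_pcompose ps pm)
  qed
  have sq: "s (q * m q) \<noteq> 0"
  proof
    assume "s (q * m q) = 0"
    hence "poly (q * m q) x = 0" for x using ps[of "q * m q" "c * x"] assms(2) by simp
    hence "q * m q = 0" using poly_all_0_iff_0 by blast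
    thus False using Q(2) q0 by simp
  qed
  have B0: "B \<noteq> 0" using sq B by auto
  define P where "P = to_fract A / to_fract B"
  have evP: "eventually (\<lambda>w. ratfun_val P w = poly A w / poly B w) cofinite"
    using ratfun_val_Fract[OF B0, of A] by (simp add: P_def)
  \<comment> \<open>Each value has only finitely many square roots, so squaring pulls finite
    exceptional sets back to finite ones.\<close>
  have sqr: "eventually (\<lambda>w. R (w ^ 2)) cofinite" if "eventually R cofinite" for R :: "complex \<Rightarrow> bool"
  proof -
    have "finite (\<Union>v\<in>{v. \<not> R v}. {w::complex. w ^ 2 = v})"
      using that by (intro finite_UN_I finite_nth_roots) (auto simp: eventually_cofinite)
    moreover have "{w. \<not> R (w ^ 2)} \<subseteq> (\<Union>v\<in>{v. \<not> R v}. {w::complex. w ^ 2 = v})" by auto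
    ultimately show ?thesis unfolding eventually_cofinite by (rule finite_subset[rotated])
  qed
  have sc: "eventually (\<lambda>w. R (w / c)) cofinite" if "eventually R cofinite" for R :: "complex \<Rightarrow> bool"
    using eventually_cofinite_scale[OF that, of "1 / c"] assms(2) by simp
  have "eventually (\<lambda>w. ratfun_val Q (w / c) = ratfun_val P (w ^ 2)) cofinite"
    using sqr[OF evP] sc[OF evQ] sc[OF eventually_cofinite_poly_neq_0[OF q0]]
  proof eventually_elim
    case (elim w)
    have "poly (pcompose A [:0, 0, 1:]) w = poly A (w ^ 2)" "poly (pcompose B [:0, 0, 1:]) w = poly B (w ^ 2)"
      by (simp_all add: poly_pcompose power2_eq_square)
    hence "poly A (w ^ 2) = poly (p * m q) (w / c)" "poly B (w ^ 2) = poly (q * m q) (w / c)"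
      unfolding A[symmetric] B[symmetric] ps by simp_all
    thus ?case using elim by simp
  qed
  note ev = this
  have "ratfun_eval Q (map_option (\<lambda>w. w / c) x) = ratfun_eval P (map_option (\<lambda>w. w ^ 2) x)" for x
  proof (rule sphere_tendsto_unique[OF punctured_nhds_neq_bot[of x]])
    show "sphere_tendsto (\<lambda>w. ratfun_val Q (w / c)) (ratfun_eval Q (map_option (\<lambda>w. w / c) x)) (punctured_nhds x)"
      by (rule sphere_tendsto_ratfun[OF sphere_tendsto_divide[OF sphere_tendsto_punctured_nhds assms(2)]
            filter_leD[OF punctured_nhds_le_cofinite sc[OF eventually_cofinite_ratfun_den]]])
    have "sphere_tendsto (\<lambda>w. ratfun_val P (w ^ 2)) (ratfun_eval P (map_option (\<lambda>w. w ^ 2) x)) (punctured_nhds x)"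
      by (rule sphere_tendsto_ratfun[OF sphere_tendsto_square[OF sphere_tendsto_punctured_nhds]
            filter_leD[OF punctured_nhds_le_cofinite sqr[OF eventually_cofinite_ratfun_den]]])
    thus "sphere_tendsto (\<lambda>w. ratfun_val Q (w / c)) (ratfun_eval P (map_option (\<lambda>w. w ^ 2) x)) (punctured_nhds x)"
      by (simp only: sphere_tendsto_cong[OF filter_leD[OF punctured_nhds_le_cofinite ev]])
  qed
  thus ?thesis by blast
qed

section \<open>Meromorphic functions invariant under the modified action\<close>

text \<open>Where \<open>h\<close> is analytic its limit is its value, so \<open>f\<close> agrees
  with \<open>h\<close> in a punctured neighbourhood of every point. The normalised values at
  removable singularities and poles then come from the limits, and \<open>h\<close> itself need not
  be normalised.\<close>

lemma sphere_meromorphicI: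
  assumes mero: "h meromorphic_on UNIV" and lim: "\<And>z. sphere_tendsto h (f z) (at z)"
  shows "sphere_meromorphic f"
proof -
  define g where "g = (\<lambda>z. case f z of None \<Rightarrow> 0 | Some w \<Rightarrow> w)"
  have ev: "eventually (\<lambda>w. h w = g w) (at z)" for z
  proof -
    have "h meromorphic_on {z}" using mero meromorphic_on_subset by blast
    then obtain r where r: "r > 0" "h analytic_on ball z r - {z}"
      by (auto simp: meromorphic_at_iff isolated_singularity_at_def)
    have "h w = g w" if "w \<in> ball z r - {z}" for w
    proof -
      have "h analytic_on {w}" by (rule analytic_on_subset[OF r(2)]) (use that in auto)
      hence "sphere_tendsto h (Some (h w)) (at w)"
        using analytic_at_imp_isCont by (auto simp: isCont_def)
      hence "f w = Some (h w)" using sphere_tendsto_unique[OF at_neq_bot lim] by blast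
      thus ?thesis by (simp add: g_def)
    qed
    moreover have "eventually (\<lambda>w. w \<in> ball z r - {z}) (at z)"
      using r(1) by (intro eventually_at_in_open) auto
    ultimately show ?thesis by (auto elim: eventually_mono)
  qed
  have gmero: "g meromorphic_on UNIV"
  proof -
    have "g meromorphic_on {z}" for z
    proof -
      have "h meromorphic_on {z}" using mero meromorphic_on_subset by blast
      moreover have "h meromorphic_on {z} \<longleftrightarrow> g meromorphic_on {z}"
        by (rule meromorphic_on_cong) (use ev in auto)
      ultimately show ?thesis by simp
    qed
    thus ?thesis using meromorphic_on_meromorphic_at by blast
  qed
  have glim: "sphere_tendsto g (f z) (at z)" for z
    using lim[of z] sphere_tendsto_cong[OF ev[of z]] by simp
  have pole: "f z = None \<longleftrightarrow> is_pole g z" for z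
    using glim[of z] not_tendsto_and_filterlim_at_infinity[OF at_neq_bot, of g _ z]
    by (cases "f z") (auto simp: is_pole_def)
  have "(is_pole g z \<and> g z = 0) \<or> (g \<longlongrightarrow> g z) (at z)" for z
    using pole[of z] glim[of z] by (cases "f z") (auto simp: g_def)
  hence "g nicely_meromorphic_on UNIV"
    using gmero by (auto simp: nicely_meromorphic_on_def)
  thus ?thesis unfolding sphere_meromorphic_def Let_def g_def[symmetric] using pole by blast
qed

lemma sphere_meromorphicD:
  assumes "sphere_meromorphic f"
  defines "h \<equiv> (\<lambda>z. case f z of None \<Rightarrow> 0 | Some w \<Rightarrow> w)"
  shows "h meromorphic_on UNIV" "sphere_tendsto h (f z) (at z)"
proof -
  have nice: "h nicely_meromorphic_on UNIV" and pole: "f z = None \<longleftrightarrow> is_pole h z" for z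
    using assms(1) unfolding sphere_meromorphic_def Let_def h_def by auto
  show "h meromorphic_on UNIV" using nice by (simp add: nicely_meromorphic_on_def)
  show "sphere_tendsto h (f z) (at z)"
  proof (cases "f z")
    case None
    thus ?thesis using pole[of z] by (simp add: is_pole_def)
  next
    case (Some w)
    hence "\<not> is_pole h z" using pole[of z] by simp
    hence "(h \<longlongrightarrow> h z) (at z)" using nice by (auto simp: nicely_meromorphic_on_def)
    thus ?thesis using Some by (simp add: h_def)
  qed
qed

section \<open>The modified action and the generators of the group\<close>

lemma not_sense_preserving_and_reversing:
  assumes "sense_preserving g" "sense_reversing g"
  shows False
proof -
  obtain a b where g1: "norm a = 1" "g = (\<lambda>z. a * z + b)" using assms(1) by (auto simp: sense_preserving_def)
  obtain a' b' where g2: "g = (\<lambda>z. a' * cnj z + b')" using assms(2) by (auto simp: sense_reversing_def)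
  have eq: "a * z + b = a' * cnj z + b'" for z using g1(2) g2 by metis
  have "b = b'" using eq[of 0] by simp
  moreover have "a = a'" using eq[of 1] calculation by simp
  ultimately have "a * \<i> = - (a * \<i>)" using eq[of \<i>] by simp
  hence "a = 0" by simp
  thus False using g1(1) by simp
qed

lemma modified_action_preserving: "sense_preserving g \<Longrightarrow> modified_action g f = (\<lambda>z. f (g z))"
  by (simp add: modified_action_def)

text \<open>The two senses exclude each other, so the second branch of
  \<open>modified_action\<close> is really reached.\<close>

lemma modified_action_reversing:
  "sense_reversing g \<Longrightarrow> modified_action g f = (\<lambda>z. map_option cnj (f (g z)))"
  using not_sense_preserving_and_reversing[of g] by (auto simp: modified_action_def)

text \<open>\<open>modified_action\<close> is \<open>undefined\<close> off the isometries, so the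
  equation \<open>modified_action g f = f\<close> alone cannot be carried through products.
  Recording the sense along with the invariance gives a property stable under the group
  operations.\<close>

definition isometry_fixes :: "(complex \<Rightarrow> sphere) \<Rightarrow> (complex \<Rightarrow> complex) \<Rightarrow> bool" where
  "isometry_fixes f g \<longleftrightarrow> sense_preserving g \<and> (\<forall>z. f (g z) = f z) \<or>
     sense_reversing g \<and> (\<forall>z. map_option cnj (f (g z)) = f z)"

lemma isometry_fixes_imp_action: "isometry_fixes f g \<Longrightarrow> modified_action g f = f"
  unfolding isometry_fixes_def
  using modified_action_preserving[of g f] modified_action_reversing[of g f] by auto

lemma isometry_fixes_compose:
  assumes "isometry_fixes f g" "isometry_fixes f h"
  shows "isometry_fixes f (\<lambda>z. g (h z))"
proof -
  have sp: "sense_preserving (\<lambda>z. g (h z))" if "sense_preserving g \<and> sense_preserving h \<or> sense_reversing g \<and> sense_reversing h"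
    using that
  proof (elim disjE conjE)
    assume "sense_preserving g" "sense_preserving h"
    then obtain a b a' b' where *: "norm a = 1" "norm a' = 1" "g = (\<lambda>z. a * z + b)" "h = (\<lambda>z. a' * z + b')"
      unfolding sense_preserving_def by blast
    have "norm (a * a') = 1" "(\<lambda>z. g (h z)) = (\<lambda>z. (a * a') * z + (a * b' + b))"
      using * by (auto simp: norm_mult algebra_simps)
    thus ?thesis unfolding sense_preserving_def by blast
  next
    assume "sense_reversing g" "sense_reversing h"
    then obtain a b a' b' where *: "norm a = 1" "norm a' = 1" "g = (\<lambda>z. a * cnj z + b)" "h = (\<lambda>z. a' * cnj z + b')"
      unfolding sense_reversing_def by blast
    have "norm (a * cnj a') = 1" "(\<lambda>z. g (h z)) = (\<lambda>z. (a * cnj a') * z + (a * cnj b' + b))"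
      using * by (auto simp: norm_mult algebra_simps)
    thus ?thesis unfolding sense_preserving_def by blast
  qed
  have sr: "sense_reversing (\<lambda>z. g (h z))" if "sense_preserving g \<and> sense_reversing h \<or> sense_reversing g \<and> sense_preserving h"
    using that
  proof (elim disjE conjE)
    assume "sense_preserving g" "sense_reversing h"
    then obtain a b a' b' where *: "norm a = 1" "norm a' = 1" "g = (\<lambda>z. a * z + b)" "h = (\<lambda>z. a' * cnj z + b')"
      unfolding sense_preserving_def sense_reversing_def by blast
    have "norm (a * a') = 1" "(\<lambda>z. g (h z)) = (\<lambda>z. (a * a') * cnj z + (a * b' + b))"
      using * by (auto simp: norm_mult algebra_simps)
    thus ?thesis unfolding sense_reversing_def by blast
  next
    assume "sense_reversing g" "sense_preserving h"
    then obtain a b a' b' where *: "norm a = 1" "norm a' = 1" "g = (\<lambda>z. a * cnj z + b)" "h = (\<lambda>z. a' * z + b')"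
      unfolding sense_preserving_def sense_reversing_def by blast
    have "norm (a * cnj a') = 1" "(\<lambda>z. g (h z)) = (\<lambda>z. (a * cnj a') * cnj z + (a * cnj b' + b))"
      using * by (auto simp: norm_mult algebra_simps)
    thus ?thesis unfolding sense_reversing_def by blast
  qed
  have cc: "map_option cnj (map_option cnj x) = x" for x by (cases x) auto
  have flip: "f (k z) = map_option cnj (f z)" if "\<forall>z. map_option cnj (f (k z)) = f z" for k z
    using that[rule_format, of z] cc[of "f (k z)"] by simp
  show ?thesis using assms unfolding isometry_fixes_def
  proof (elim disjE conjE)
    assume "sense_preserving g" "\<forall>z. f (g z) = f z" "sense_preserving h" "\<forall>z. f (h z) = f z"
    thus "sense_preserving (\<lambda>z. g (h z)) \<and> (\<forall>z. f (g (h z)) = f z) \<or>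
      sense_reversing (\<lambda>z. g (h z)) \<and> (\<forall>z. map_option cnj (f (g (h z))) = f z)" using sp by simp
  next
    assume "sense_preserving g" "\<forall>z. f (g z) = f z" "sense_reversing h" "\<forall>z. map_option cnj (f (h z)) = f z"
    thus "sense_preserving (\<lambda>z. g (h z)) \<and> (\<forall>z. f (g (h z)) = f z) \<or>
      sense_reversing (\<lambda>z. g (h z)) \<and> (\<forall>z. map_option cnj (f (g (h z))) = f z)" using sr by simp
  next
    assume "sense_reversing g" "\<forall>z. map_option cnj (f (g z)) = f z" "sense_preserving h" "\<forall>z. f (h z) = f z"
    thus "sense_preserving (\<lambda>z. g (h z)) \<and> (\<forall>z. f (g (h z)) = f z) \<or>
      sense_reversing (\<lambda>z. g (h z)) \<and> (\<forall>z. map_option cnj (f (g (h z))) = f z)" using sr by simp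
  next
    assume *: "sense_reversing g" "\<forall>z. map_option cnj (f (g z)) = f z"
      "sense_reversing h" "\<forall>z. map_option cnj (f (h z)) = f z"
    hence "f (g (h z)) = f z" for z using flip[OF *(2), of "h z"] by simp
    thus "sense_preserving (\<lambda>z. g (h z)) \<and> (\<forall>z. f (g (h z)) = f z) \<or>
      sense_reversing (\<lambda>z. g (h z)) \<and> (\<forall>z. map_option cnj (f (g (h z))) = f z)" using sp * by simp
  qed
qed

text \<open>Bijectivity is included because \<open>BijGroup UNIV\<close> computes products and
  inverses as those of functions only on bijections.\<close>

lemma isometry_fixes_inverse:
  assumes "isometry_fixes f g"
  shows "bij g" "isometry_fixes f (inv_into UNIV g)"
proof -
  have cc: "map_option cnj (map_option cnj x) = x" for x by (cases x) auto
  consider (p) a b where "norm a = 1" "g = (\<lambda>z. a * z + b)" "\<And>z. f (g z) = f z"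
    | (r) a b where "norm a = 1" "g = (\<lambda>z. a * cnj z + b)" "\<And>z. map_option cnj (f (g z)) = f z"
    using assms unfolding isometry_fixes_def sense_preserving_def sense_reversing_def by blast
  hence "bij g \<and> isometry_fixes f (inv_into UNIV g)"
  proof cases
    case p
    have aa: "a * cnj a = 1" using p(1) by (simp flip: complex_norm_square)
    define k where "k = (\<lambda>z. cnj a * z + (- cnj a * b))"
    have gk: "g (k z) = z" "k (g z) = z" for z
    proof -
      have "g (k z) = (a * cnj a) * z - (a * cnj a) * b + b" "k (g z) = (a * cnj a) * z"
        unfolding p(2) k_def by (simp_all add: algebra_simps)
      thus "g (k z) = z" "k (g z) = z" unfolding aa by simp_all
    qed
    have b: "bij g" by (rule bij_betw_byWitness[of _ k]) (use gk in auto)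
    have inv: "inv_into UNIV g = k" by (rule inv_equality) (use gk in auto)
    have "sense_preserving k" unfolding sense_preserving_def k_def using p(1) by (metis complex_mod_cnj)
    thus ?thesis using b inv p(3) gk unfolding isometry_fixes_def by metis
  next
    case r
    have aa: "a * cnj a = 1" using r(1) by (simp flip: complex_norm_square)
    \<comment> \<open>Since \<open>a * cnj a = 1\<close>, solving \<open>w = a * cnj z + b\<close>
      for \<open>z\<close> gives \<open>a * cnj (w - b)\<close>.\<close>
    define k where "k = (\<lambda>z. a * cnj z + (- a * cnj b))"
    have gk: "g (k z) = z" "k (g z) = z" for z
    proof -
      have "g (k z) = (a * cnj a) * z - (a * cnj a) * b + b" "k (g z) = (a * cnj a) * z"
        unfolding r(2) k_def by (simp_all add: algebra_simps)
      thus "g (k z) = z" "k (g z) = z" unfolding aa by simp_all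
    qed
    have b: "bij g" by (rule bij_betw_byWitness[of _ k]) (use gk in auto)
    have inv: "inv_into UNIV g = k" by (rule inv_equality) (use gk in auto)
    have "sense_reversing k" unfolding sense_reversing_def k_def using r(1) by metis
    thus ?thesis using b inv r(3) gk cc unfolding isometry_fixes_def by metis
  qed
  thus "bij g" "isometry_fixes f (inv_into UNIV g)" by auto
qed

lemma isometry_fixes_generate:
  assumes "\<And>g. g \<in> H \<Longrightarrow> isometry_fixes f g" "g \<in> generate (BijGroup UNIV) H"
  shows "isometry_fixes f g"
  using assms(2)
proof (induction rule: generate.induct)
  case one
  have "isometry_fixes f (\<lambda>z. z)"
  proof -
    have "sense_preserving (\<lambda>z. z)"
      unfolding sense_preserving_def by (rule exI[of _ 1], rule exI[of _ 0]) simp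
    thus ?thesis by (simp add: isometry_fixes_def)
  qed
  thus ?case by (simp add: BijGroup_def restrict_UNIV)
next
  case (incl h)
  thus ?case by (rule assms(1))
next
  case (inv h)
  have fx: "isometry_fixes f h" by (rule assms(1)[OF inv])
  hence "h \<in> Bij UNIV" using isometry_fixes_inverse(1) by (simp add: Bij_def)
  hence "inv\<^bsub>BijGroup UNIV\<^esub> h = inv_into UNIV h" by (simp add: inv_BijGroup restrict_UNIV)
  thus ?case using isometry_fixes_inverse(2)[OF fx] by simp
next
  case (eng h1 h2)
  have "h1 \<in> Bij UNIV" "h2 \<in> Bij UNIV"
    using eng.IH isometry_fixes_inverse(1) by (auto simp: Bij_def)
  hence "h1 \<otimes>\<^bsub>BijGroup UNIV\<^esub> h2 = (\<lambda>z. h1 (h2 z))"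
    by (simp add: BijGroup_def compose_def restrict_UNIV)
  thus ?case using isometry_fixes_compose[OF eng.IH] by simp
qed

lemma glide_L_sense_reversing: "sense_reversing (glide_L \<alpha>)"
  unfolding sense_reversing_def
  by (rule exI[of _ 1], rule exI[of _ "cnj (of_real \<alpha> * (1 + \<i>) / 2)"]) (simp add: glide_L_def fun_eq_iff)

text \<open>Being fixed passes to products and inverses, so the generators suffice; their senses
  turn the action into three functional equations.\<close>

lemma modified_invariant_p4mg_iff:
  "modified_invariant (p4mg \<alpha>) f \<longleftrightarrow>
     (\<forall>\<omega>\<in>square_lattice \<alpha>. \<forall>z. f (z + \<omega>) = f z) \<and> (\<forall>z. f (\<i> * z) = f z) \<and>
     (\<forall>z. map_option cnj (f (glide_L \<alpha> z)) = f z)"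
  (is "_ \<longleftrightarrow> ?R")
proof -
  define H where "H = {(\<lambda>z. z + \<omega>) | \<omega>. \<omega> \<in> square_lattice \<alpha>} \<union> {(\<lambda>z. \<i> * z), glide_L \<alpha>}"
  have tr: "sense_preserving (\<lambda>z. z + \<omega>)" for \<omega>
    unfolding sense_preserving_def by (rule exI[of _ 1], rule exI[of _ \<omega>]) simp
  have rot: "sense_preserving (\<lambda>z. \<i> * z)"
    unfolding sense_preserving_def by (rule exI[of _ \<i>], rule exI[of _ 0]) simp
  show ?thesis
  proof
    assume inv: "modified_invariant (p4mg \<alpha>) f"
    have gen: "modified_action g f = f" if "g \<in> H" for g
      using inv that generate.incl[of g H "BijGroup UNIV"]
      unfolding modified_invariant_def p4mg_def H_def by blast
    have "f (z + \<omega>) = f z" if "\<omega> \<in> square_lattice \<alpha>" for \<omega> z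
    proof -
      have "(\<lambda>z. z + \<omega>) \<in> H" using that by (auto simp: H_def)
      from gen[OF this] show ?thesis unfolding modified_action_preserving[OF tr] by metis
    qed
    moreover have "f (\<i> * z) = f z" for z
    proof -
      have "(\<lambda>z. \<i> * z) \<in> H" by (auto simp: H_def)
      from gen[OF this] show ?thesis unfolding modified_action_preserving[OF rot] by metis
    qed
    moreover have "map_option cnj (f (glide_L \<alpha> z)) = f z" for z
    proof -
      have "glide_L \<alpha> \<in> H" by (auto simp: H_def)
      from gen[OF this] show ?thesis unfolding modified_action_reversing[OF glide_L_sense_reversing] by metis
    qed
    ultimately show ?R by blast
  next
    assume R: ?R
    have "isometry_fixes f g" if "g \<in> H" for g
      using that R tr rot glide_L_sense_reversing unfolding H_def isometry_fixes_def by auto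
    thus "modified_invariant (p4mg \<alpha>) f"
      unfolding modified_invariant_def p4mg_def H_def[symmetric]
      using isometry_fixes_generate isometry_fixes_imp_action by blast
  qed
qed

theorem mainTheorem11:
  fixes \<alpha> :: real and \<Lambda> :: "complex set" and e1 e2 e3 a c :: complex
    and f :: "complex \<Rightarrow> sphere"
  assumes "\<alpha> > 0"
    and "\<Lambda> = square_lattice \<alpha>"
    and "e1 = weierstrass_val \<Lambda> (of_real \<alpha> / 2)"
    and "e2 = weierstrass_val \<Lambda> (of_real \<alpha> * \<i> / 2)"
    and "e3 = weierstrass_val \<Lambda> (of_real \<alpha> * (1 + \<i>) / 2)"
    and "a = e3"
    and "c = csqrt ((e1 - e3) * (e3 - e2))"
  shows "sphere_meromorphic f \<and> modified_invariant (p4mg \<alpha>) f \<longleftrightarrow>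
    (\<exists>Q. antipodal_form Q \<and>
         (\<exists>P. \<forall>w :: sphere. ratfun_eval Q (map_option (\<lambda>w. (w - a) / c) w)
                           = ratfun_eval P (map_option (\<lambda>w. w ^ 2) w)) \<and>
         f = (\<lambda>z. ratfun_eval Q (map_option (\<lambda>w. (w - a) / c) (weierstrass_p \<Lambda> z))))"
proof -
  interpret square_weierstrass \<alpha> by unfold_locales (rule assms(1))
  have L: "\<Lambda> = L" by (simp add: assms(2) L_def)
  define e where "e = wp (of_real \<alpha> / 2)"
  have e: "e1 = e" "e2 = - e" "e3 = 0"
    using assms(3-5) wp_half_i wp_w3 by (simp_all add: L e_def w3_def flip: wp_def)
  have "e \<in> \<real>" using wp_half_real by (simp add: e_def Reals_cnj_iff)
  then obtain x where x: "e = of_real x" by (rule Reals_cases)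
  \<comment> \<open>The principal square root of \<open>x ^ 2\<close> is the absolute value of
    \<open>x\<close>, whatever the sign of \<open>e\<close>.\<close>
  define d where "d = \<bar>x\<bar>"
  have d0: "d \<noteq> 0" using wp_half_neq_0 x by (simp add: d_def e_def)
  have d2: "complex_of_real (d ^ 2) = wp (of_real \<alpha> / 2) ^ 2" using x by (simp add: d_def e_def)
  have "(e1 - e3) * (e3 - e2) = of_real (x ^ 2)" by (simp add: e x power2_eq_square)
  hence c: "c = of_real d" using assms(7) by (simp add: d_def csqrt_of_real_nonneg)
  have ac: "(\<lambda>w. (w - a) / c) = (\<lambda>w. w / of_real d)" by (simp add: assms(6) e(3) c)
  have dc: "complex_of_real d \<noteq> 0" using d0 by simp
  define S where "S = (\<lambda>z. map_option (\<lambda>w. w / of_real d) (weierstrass_p L z))"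
  have S_eq: "map_option (\<lambda>w. w / of_real d) (weierstrass_p L z) = S z" for z
    by (simp add: S_def)
  have S_lim: "sphere_tendsto (\<lambda>z. wp z / of_real d) (S z) (at z)" for z
    unfolding S_def by (rule sphere_tendsto_divide[OF wp_tendsto dc])
  have S_Some: "S z = Some (wp z / of_real d)" if "z \<notin> L" for z
    using that by (simp add: S_def weierstrass_p_def wp_def)
  have S_glide: "S (glide_L \<alpha> z) = sphere_antipode (S z)" for z
    unfolding S_def by (rule weierstrass_p_glide[OF d0 d2])
  have S_rot: "S (\<i> * z) = map_option uminus (S z)" for z
    unfolding S_def weierstrass_p_mult_i by (cases "weierstrass_p L z") simp_all
  have generic: "eventually (\<lambda>z. P (wp z / of_real d)) (at z0)" if "eventually P cofinite" for P z0
  proof -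
    have "finite {w. \<not> P w}" using that by (simp add: eventually_cofinite)
    hence "eventually (\<lambda>z. \<forall>w\<in>{w. \<not> P w}. wp z \<noteq> w * of_real d) (at z0)"
      by (intro eventually_ball_finite ballI wp_eventually_neq)
    thus ?thesis
    proof eventually_elim
      case (elim z)
      have "wp z = (wp z / of_real d) * of_real d" using dc by simp
      thus ?case using elim by blast
    qed
  qed
  \<comment> \<open>A property holding along \<open>wp z / d\<close> near the pole holds at
    infinitely many points, since finitely many values would be avoided there. This is how
    functional equations in \<open>z\<close> become identities in \<open>w\<close>.\<close>
  have infinite: "infinite {w. P w}" if "eventually (\<lambda>z. P (wp z / of_real d)) (at 0)" for P
  proof
    assume "finite {w. P w}"
    hence "eventually (\<lambda>w. \<not> P w) cofinite" by (simp add: eventually_cofinite)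
    from generic[OF this, of 0] that have "eventually (\<lambda>z::complex. False) (at 0)"
      by eventually_elim simp
    thus False by simp
  qed
  have comp_lim: "sphere_tendsto (\<lambda>z. ratfun_val R (wp z / of_real d)) (ratfun_eval R (S z)) (at z)" for R z
    by (rule sphere_tendsto_ratfun[OF S_lim generic[OF eventually_cofinite_ratfun_den]])
  have cc: "map_option cnj (map_option cnj y) = y" for y by (cases y) auto
  show ?thesis
    unfolding ac L S_eq modified_invariant_p4mg_iff L_def[symmetric]
  proof (intro iffI)
    assume "sphere_meromorphic f \<and> (\<forall>\<omega>\<in>L. \<forall>z. f (z + \<omega>) = f z) \<and> (\<forall>z. f (\<i> * z) = f z) \<and>
      (\<forall>z. map_option cnj (f (glide_L \<alpha> z)) = f z)"
    hence mero: "sphere_meromorphic f" and tr: "\<And>z \<omega>. \<omega> \<in> L \<Longrightarrow> f (z + \<omega>) = f z"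
      and rot: "\<And>z. f (\<i> * z) = f z" and gl: "\<And>z. map_option cnj (f (glide_L \<alpha> z)) = f z" by auto
    define h where "h = (\<lambda>z. case f z of None \<Rightarrow> 0 | Some w \<Rightarrow> w)"
    note h = sphere_meromorphicD[OF mero, folded h_def]
    have "f (- z) = f z" for z using rot[of "\<i> * z"] rot[of z] by (simp flip: mult.assoc)
    hence even: "h (- z) = h z" for z by (simp add: h_def)
    have per: "h (z + \<omega>) = h z" if "\<omega> \<in> L" for z \<omega> using tr[OF that] by (simp add: h_def)
    obtain A B where B0: "B \<noteq> 0"
      and AB: "\<And>z. eventually (\<lambda>w. h w * poly B (wp w) = poly A (wp w)) (at z)"
      using elliptic_even_rational[OF h(1) per even] by blast
    define scale where "scale = (\<lambda>p :: complex poly. pcompose p [:0, of_real d:])"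
    have scale: "poly (scale p) (w / of_real d) = poly p w" for p w
      using dc by (simp add: scale_def poly_pcompose)
    have sB: "scale B \<noteq> 0"
    proof
      assume "scale B = 0"
      hence "poly B w = 0" for w using scale[of B w] by simp
      thus False using B0 poly_all_0_iff_0 by blast
    qed
    define Q where "Q = to_fract (scale A) / to_fract (scale B)"
    have hQ: "eventually (\<lambda>w. h w = ratfun_val Q (wp w / of_real d)) (at z)" for z
      using AB[of z] generic[OF ratfun_val_Fract[OF sB, of "scale A"], of z]
        generic[OF eventually_cofinite_poly_neq_0[OF sB], of z]
      unfolding scale Q_def[symmetric]
    proof eventually_elim
      case (elim w)
      thus ?case by (metis nonzero_mult_div_cancel_right)
    qed
    \<comment> \<open>Agreement of \<open>h\<close> with \<open>Q\<close> off isolated points passes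
      to the limit and gives the value of \<open>f\<close> on the sphere at every point, poles
      included.\<close>
    have fQ: "f z = ratfun_eval Q (S z)" for z
    proof (rule sphere_tendsto_unique[OF at_neq_bot[of z]])
      show "sphere_tendsto (\<lambda>z. ratfun_val Q (wp z / of_real d)) (f z) (at z)"
        using h(2)[of z] sphere_tendsto_cong[OF hQ[of z]] by simp
    qed (rule comp_lim)
    \<comment> \<open>The points used avoid the lattice, the zeros of \<open>wp\<close> and the
      poles of \<open>Q\<close> at \<open>w\<close> and at its antipode, so that all values are
      finite and can be compared as complex numbers.\<close>
    have "eventually (\<lambda>z. ratfun_val Q (wp z / of_real d) =
        cnj (ratfun_val Q (- 1 / cnj (wp z / of_real d)))) (at 0)"
      using eventually_notin_L[of 0] wp_eventually_neq[of 0 0] generic[OF eventually_cofinite_ratfun_den[of Q], of 0]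
        generic[OF eventually_cofinite_antipode[OF eventually_cofinite_ratfun_den[of Q]], of 0]
    proof eventually_elim
      case (elim z)
      have "sphere_antipode (S z) = Some (- 1 / cnj (wp z / of_real d))"
        unfolding S_Some[OF elim(1)] using elim(2) dc by (simp add: sphere_antipode_def)
      hence "f (glide_L \<alpha> z) = Some (ratfun_val Q (- 1 / cnj (wp z / of_real d)))"
        unfolding fQ S_glide using ratfun_eval_Some[OF elim(4)] by simp
      moreover have "f z = Some (ratfun_val Q (wp z / of_real d))"
        unfolding fQ S_Some[OF elim(1)] by (rule ratfun_eval_Some[OF elim(3)])
      ultimately show ?case using gl[of z] by simp
    qed
    hence "antipodal_form Q"
      by (intro antipodal_symmetric_imp_form antipodal_symmetricI infinite)
    moreover have neg: "eventually (\<lambda>w. poly (snd (quot_of_fract Q)) (- w) \<noteq> 0) cofinite"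
      using eventually_cofinite_scale[OF eventually_cofinite_ratfun_den[of Q], of "-1"] by simp
    have "eventually (\<lambda>z. ratfun_val Q (- (wp z / of_real d)) = ratfun_val Q (wp z / of_real d)) (at 0)"
      using eventually_notin_L[of 0] generic[OF eventually_cofinite_ratfun_den[of Q], of 0]
        generic[OF neg, of 0]
    proof eventually_elim
      case (elim z)
      have "f (\<i> * z) = Some (ratfun_val Q (- (wp z / of_real d)))"
        unfolding fQ S_rot S_Some[OF elim(1)] using ratfun_eval_Some[of Q "- (wp z / of_real d)"] elim(3) by simp
      moreover have "f z = Some (ratfun_val Q (wp z / of_real d))"
        unfolding fQ S_Some[OF elim(1)] by (rule ratfun_eval_Some[OF elim(2)])
      ultimately show ?case using rot[of z] by simp
    qed
    hence "\<exists>P. \<forall>w. ratfun_eval Q (map_option (\<lambda>w. w / of_real d) w) = ratfun_eval P (map_option (\<lambda>w. w ^ 2) w)"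
      by (intro even_ratfun_eval_square infinite dc)
    moreover have "f = (\<lambda>z. ratfun_eval Q (S z))" using fQ by blast
    ultimately show "\<exists>Q. antipodal_form Q \<and>
        (\<exists>P. \<forall>w. ratfun_eval Q (map_option (\<lambda>w. w / of_real d) w) = ratfun_eval P (map_option (\<lambda>w. w ^ 2) w)) \<and>
        f = (\<lambda>z. ratfun_eval Q (S z))" by blast
  next
    assume "\<exists>Q. antipodal_form Q \<and>
        (\<exists>P. \<forall>w. ratfun_eval Q (map_option (\<lambda>w. w / of_real d) w) = ratfun_eval P (map_option (\<lambda>w. w ^ 2) w)) \<and>
        f = (\<lambda>z. ratfun_eval Q (S z))"
    then obtain Q P where form: "antipodal_form Q"
      and P: "\<And>w. ratfun_eval Q (map_option (\<lambda>w. w / of_real d) w) = ratfun_eval P (map_option (\<lambda>w. w ^ 2) w)"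
      and f: "f = (\<lambda>z. ratfun_eval Q (S z))" by blast
    have "(\<lambda>z. ratfun_val Q (wp z / of_real d)) meromorphic_on UNIV"
      unfolding ratfun_val_def
      by (intro meromorphic_on_divide meromorphic_on_poly wp_meromorphic meromorphic_on_const)
    hence "sphere_meromorphic f"
      by (rule sphere_meromorphicI) (simp add: f comp_lim)
    moreover have "f (z + \<omega>) = f z" if "\<omega> \<in> L" for \<omega> z
      using weierstrass_p_add_lattice[OF that] by (simp add: f S_def)
    moreover have "f (\<i> * z) = f z" for z
    proof -
      \<comment> \<open>Points \<open>w\<close> and \<open>- w\<close> have the same square, so
        \<open>P\<close> supplies the invariance under the rotation.\<close>
      have "map_option (\<lambda>w. w ^ 2) (map_option uminus y) = map_option (\<lambda>w. w ^ 2) y" for y :: sphere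
        by (cases y) simp_all
      thus ?thesis by (simp only: f S_def weierstrass_p_mult_i P)
    qed
    moreover have "map_option cnj (f (glide_L \<alpha> z)) = f z" for z
      using ratfun_eval_antipode[OF antipodal_form_imp_symmetric[OF form]] by (simp only: f S_glide cc)
    ultimately show "sphere_meromorphic f \<and> (\<forall>\<omega>\<in>L. \<forall>z. f (z + \<omega>) = f z) \<and> (\<forall>z. f (\<i> * z) = f z) \<and>
      (\<forall>z. map_option cnj (f (glide_L \<alpha> z)) = f z)" by blast
  qed
qed

end
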